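(* Assume that $(\alpha,\rho_1)$ and $(\alpha,\rho_2)$ belong to $\mathcal{A}$. Let $X_{\alpha,\rho_1}$ and $X_{\alpha,\rho_2}$ be independent real random variables with the free stable distributions $\nu_{\alpha,\rho_1}$ and $\nu_{\alpha,\rho_2}$, respectively. Then $$\frac{X_{\alpha,\rho_1}}{X_{\alpha,\rho_2}}\stackrel{d}{=}\frac{X_{\alpha,\rho_2}}{X_{\alpha,\rho_1}}.$$ If moreover $\rho_1$ and $\rho_2$ are nonzero, and $\hat X_{\alpha,\rho_1}$, $\hat X_{\alpha,\rho_2}$ are independent random variables distributed as the cutoffs of $X_{\alpha,\rho_1}$ and $X_{\alpha,\rho_2}$, respectively, then $$\frac{\hat X_{\alpha,\rho_1}}{\hat X_{\alpha,\rho_2}}\stackrel{d}{=}\frac{\hat X_{\alpha,\rho_2}}{\hat X_{\alpha,\rho_1}}.$$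
   Context: The set of admissible parameters is $$\mathcal{A}=\{(\alpha,\rho):\alpha\in(0,1),\ \rho\in[0,1]\}\cup\{(\alpha,\rho):\alpha\in(1,2],\ \rho\in[1-\alpha^{-1},\alpha^{-1}]\}.$$ All powers use the principal branch. For $(\alpha,\rho)\in\mathcal{A}$, the free stable distribution $\nu_{\alpha,\rho}$ is the probability measure on $\mathbb{R}$ (known to exist and be unique) whose Voiculescu transform is $\phi_{\alpha,\rho}(z)=-e^{\pi i\alpha\rho}z^{-\alpha+1}$ for $\operatorname{Im}(z)>0$. This means that its Cauchy transform $G_{\alpha,\rho}(z)=\int_{\mathbb{R}}\frac{\nu_{\alpha,\rho}(dx)}{z-x}$, $\operatorname{Im}(z)>0$ (which takes values in the lower half-plane), is the inverse function of $w\mapsto \frac1w+\phi_{\alpha,\rho}(\frac1w)$, i.e. $w=G_{\alpha,\rho}(z)$ satisfies $z=w^{-1}-e^{\pi i\alpha\rho}w^{\alpha-1}$ for all $z$ with $\operatorname{Im}(z)>0$. The measures $\nu_{\alpha,\rho}$ are absolutely continuous, so the ratios are defined almost surely. If $\xi$ is a real random variable with $\mathbb{P}(\xi>0)>0$, its cutoff $\hat\xi$ is a positive random variable with distribution $\mathbb{P}(\hat\xi\in A)=\mathbb{P}(\xi\in A\mid\xi>0)$ for all Borel sets $A\subseteq(0,\infty)$. The symbol $\stackrel{d}{=}$ denotes equality in distribution. *)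

theory Defs
  imports "HOL-Probability.Probability"
begin

definition admissible :: "(real \<times> real) set" where
  "admissible =
     {(\<alpha>, \<rho>). \<alpha> \<in> {0<..<1} \<and> \<rho> \<in> {0..1}} \<union>
     {(\<alpha>, \<rho>). \<alpha> \<in> {1<..2} \<and> \<rho> \<in> {1 - inverse \<alpha>..inverse \<alpha>}}"

definition cauchy_transform :: "real measure \<Rightarrow> complex \<Rightarrow> complex" where
  "cauchy_transform \<nu> z = (CLINT x|\<nu>. 1 / (z - complex_of_real x))"

text \<open>
  The Voiculescu transform is taken on the whole upper half-plane: the Cauchy transform
  \<open>G\<close> inverts \<open>w \<mapsto> 1/w + \<phi> (1/w)\<close>, that is, \<open>w = G z\<close> solves \<open>1/w + \<phi> (1/w) = z\<close> whenever
  \<open>Im z > 0\<close>. As \<open>G\<close> maps into the lower half-plane, \<open>\<phi>\<close> is only evaluated in the upper one.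
\<close>
definition has_voiculescu_transform :: "real measure \<Rightarrow> (complex \<Rightarrow> complex) \<Rightarrow> bool" where
  "has_voiculescu_transform \<nu> \<phi> \<longleftrightarrow>
     (\<forall>z. Im z > 0 \<longrightarrow> (let w = cauchy_transform \<nu> z in 1 / w + \<phi> (1 / w) = z))"

definition free_stable_transform :: "real \<Rightarrow> real \<Rightarrow> complex \<Rightarrow> complex" where
  "free_stable_transform \<alpha> \<rho> z =
     - exp (complex_of_real (pi * \<alpha> * \<rho>) * \<i>) * z powr complex_of_real (- \<alpha> + 1)"

lemma free_stable_transform_inverse:
  assumes "Im w < 0"
  shows "1 / w + free_stable_transform \<alpha> \<rho> (1 / w) =
    1 / w - exp (complex_of_real (pi * \<alpha> * \<rho>) * \<i>) * w powr complex_of_real (\<alpha> - 1)"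
proof -
  have "w \<notin> \<real>\<^sub>\<le>\<^sub>0" "w \<noteq> 0"
    using assms by (auto simp: complex_nonpos_Reals_iff)
  then have "Ln (1 / w) = - Ln w"
    by (simp add: Ln_inverse divide_inverse)
  then show ?thesis
    using \<open>w \<noteq> 0\<close> by (simp add: free_stable_transform_def powr_def algebra_simps)
qed

definition free_stable_distribution :: "real \<Rightarrow> real \<Rightarrow> real measure \<Rightarrow> bool" where
  "free_stable_distribution \<alpha> \<rho> \<nu> \<longleftrightarrow>
     real_distribution \<nu> \<and> has_voiculescu_transform \<nu> (free_stable_transform \<alpha> \<rho>)"

text \<open>
  \<open>is_cutoff M \<xi> N \<eta>\<close>: the random variable \<open>\<eta>\<close> on \<open>N\<close> is distributed as the cutoff of
  the random variable \<open>\<xi>\<close> on \<open>M\<close>. Positivity is required almost surely.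
\<close>
definition is_cutoff ::
    "'a measure \<Rightarrow> ('a \<Rightarrow> real) \<Rightarrow> 'b measure \<Rightarrow> ('b \<Rightarrow> real) \<Rightarrow> bool" where
  "is_cutoff M \<xi> N \<eta> \<longleftrightarrow>
     \<eta> \<in> borel_measurable N \<and> (AE \<omega> in N. \<eta> \<omega> > 0) \<and>
     (\<forall>A\<in>sets borel. A \<subseteq> {0<..} \<longrightarrow>
        \<P>(\<omega> in N. \<eta> \<omega> \<in> A) = \<P>(\<omega> in M. \<xi> \<omega> \<in> A \<bar> \<xi> \<omega> > 0))"

end

theory Submission
  imports Defs "HOL-Real_Asymp.Real_Asymp" "HOL-Complex_Analysis.Conformal_Mappings"
begin

text \<open>
  The law of a nonzero real variable \<open>X\<close> is determined by the two functions
  \<open>t \<mapsto> E[\<bar>X\<bar> powr (i t); X > 0]\<close> and \<open>t \<mapsto> E[\<bar>X\<bar> powr (i t); X < 0]\<close>, and inverting \<open>X\<close> replaces \<open>t\<close> by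
  \<open>- t\<close>. For a free stable law and \<open>t \<noteq> 0\<close> they equal \<open>sinh (\<pi> \<rho> t) D(t)\<close> and \<open>sinh (\<pi> (1 - \<rho>) t) D(t)\<close>, where \<open>D\<close>
  depends on \<open>\<alpha>\<close> only (\<open>free_stable_mellin\<close>). For independent \<open>X\<^sub>1\<close> and \<open>X\<^sub>2\<close> the transforms of the ratio
  are sums of products, one factor at \<open>t\<close> and the other at \<open>- t\<close>. In each product the two \<open>sinh\<close> factors
  change sign under \<open>t \<mapsto> - t\<close>, while \<open>D(t) D(- t)\<close> is even. Hence the product is even, and the law of
  the ratio is invariant under inversion (\<open>inversion_invariant\<close>). The argument works for each choice of
  signs separately, which is why it also covers the cutoffs.

  The factorization comes from the Cauchy transform \<open>G\<close>. With \<open>u = exp (i \<pi> \<rho>) G(z)\<close> the defining equation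
  becomes \<open>z exp (- i \<pi> \<rho>) u + u powr \<alpha> = 1\<close> (\<open>free_stable_trinomial\<close>). On the ray \<open>z = r exp (i \<pi> \<rho>)\<close> it
  reads \<open>r u + u powr \<alpha> = 1\<close>; its only root off the negative half-line is real and positive, and it does
  not depend on \<open>\<rho>\<close> (\<open>trinomial_root_positive\<close>, \<open>trinomial_root_unique\<close>). So
  \<open>z G(z) = E[r / (r + a)]\<close>, with \<open>a = - X exp (- i \<pi> \<rho>)\<close>, is a real function of \<open>r\<close> determined by \<open>\<alpha>\<close>.
  Its derivative is \<open>E[a / (r + a)\<^sup>2]\<close>, and the integral of \<open>r powr (i t) a / (r + a)\<^sup>2\<close> over \<open>r > 0\<close> is
  \<open>a powr (i t)\<close> times the nonzero constant \<open>\<Gamma> (1 + i t) \<Gamma> (1 - i t)\<close> (\<open>power_kernel_integral_eq\<close>,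
  \<open>power_kernel_integral_1\<close>). Thus \<open>E[a powr (i t)]\<close> depends on \<open>\<alpha>\<close> only. Since the profile is real, the
  same value is obtained with the conjugate of \<open>a\<close>. These are two linear equations for the two signed
  transforms, and solving them gives the \<open>sinh\<close> factors.

  For \<open>\<rho> = 1\<close> (where \<open>\<alpha> < 1\<close>) the ray is the boundary of the upper half-plane. There the equation first
  yields that the law is carried by the nonnegative half-line (\<open>one_sided_AE_nonneg\<close>), and then extends
  to the ray by continuity. The case \<open>\<rho> = 0\<close> follows by reflection.
\<close>

section \<open>The Mellin transform of the kernel $a/(r+a)^2$\<close>

definition power_kernel_integral :: "real \<Rightarrow> complex \<Rightarrow> complex" where
  "power_kernel_integral t a =
     (LINT r:{0<..}|lborel. cis (t * ln r) * (a / (complex_of_real r + a)\<^sup>2))"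

lemma borel_measurable_cis [measurable (raw)]:
  "f \<in> borel_measurable M \<Longrightarrow> (\<lambda>x. cis (f x)) \<in> borel_measurable M"
  by (rule borel_measurable_continuous_on) (intro continuous_intros)

text \<open>
  A point off the closed negative half-line has positive distance from it, which gives the bound for
  small \<open>r\<close>; for large \<open>r\<close> the triangle inequality takes over. The bound makes all integrands
  below \<open>O(1 / (r + 1)\<^sup>2)\<close>.
\<close>
lemma norm_add_lower_bound:
  assumes "a \<notin> \<real>\<^sub>\<le>\<^sub>0"
  obtains c where "c > 0" "\<And>r. r \<ge> 0 \<Longrightarrow> c * (r + 1) \<le> norm (complex_of_real r + a)"
proof -
  have "open (- \<real>\<^sub>\<le>\<^sub>0 :: complex set)"
    by (simp add: open_Compl)
  then obtain e where e: "e > 0" "ball a e \<subseteq> - \<real>\<^sub>\<le>\<^sub>0"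
    using assms by (meson ComplI openE)
  have far: "e \<le> norm (complex_of_real r + a)" if "r \<ge> 0" for r
  proof (rule ccontr)
    assume "\<not> e \<le> norm (complex_of_real r + a)"
    then have "- complex_of_real r \<in> ball a e"
      by (simp add: dist_norm add.commute)
    then show False
      using e(2) that by (auto simp: complex_nonpos_Reals_iff)
  qed
  \<comment> \<open>from \<open>r + 1 \<le> \<bar>r + a\<bar> + (\<bar>a\<bar> + 1)\<close> and \<open>e \<le> \<bar>r + a\<bar>\<close>\<close>
  define c where "c = 1 / (1 + (norm a + 1) / e)"
  have pos: "0 < 1 + (norm a + 1) / e"
    using e(1) by (smt (verit) divide_nonneg_pos norm_ge_zero)
  have "c * (r + 1) \<le> norm (complex_of_real r + a)" if r: "r \<ge> 0" for r
  proof -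
    have "r = norm ((complex_of_real r + a) - a)"
      using r by simp
    also have "\<dots> \<le> norm (complex_of_real r + a) + norm a"
      by (rule norm_triangle_ineq4)
    finally have "r + 1 \<le> norm (complex_of_real r + a) + (norm a + 1) / e * e"
      using e(1) by simp
    also have "\<dots> \<le> norm (complex_of_real r + a) + (norm a + 1) / e * norm (complex_of_real r + a)"
      using e(1) far[OF r] by (intro add_left_mono mult_left_mono) auto
    finally have "r + 1 \<le> (1 + (norm a + 1) / e) * norm (complex_of_real r + a)"
      by (simp add: algebra_simps)
    then show ?thesis
      using pos by (simp add: c_def field_simps)
  qed
  moreover have "c > 0"
    using pos by (simp add: c_def)
  ultimately show ?thesis
    using that by blast
qed

lemma nn_integral_inverse_square_shift:
  fixes A :: real
  assumes "A > 0"
  shows "(\<integral>\<^sup>+(r::real). ennreal (A / (r + A)\<^sup>2) * indicator {0..} r \<partial>lborel) = 1"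
proof -
  have "(\<integral>\<^sup>+(r::real). ennreal (A / (r + A)\<^sup>2) * indicator {0..} r \<partial>lborel) = 0 - (- A / (0 + A))"
  proof (rule nn_integral_FTC_atLeast)
    show "((\<lambda>r. - A / (r + A)) has_real_derivative A / (x + A)\<^sup>2) (at x)" if "0 \<le> x" for x
      using that assms by (auto intro!: derivative_eq_intros simp: power2_eq_square)
    show "((\<lambda>r. - A / (r + A)) \<longlongrightarrow> 0) at_top"
    proof (rule tendsto_divide_0[OF tendsto_const filterlim_at_top_imp_at_infinity])
      show "LIM r at_top. r + A :> at_top"
        using filterlim_tendsto_add_at_top[OF tendsto_const[of A] filterlim_ident]
        by (simp add: add.commute)
    qed
  qed (use assms in auto)
  then show ?thesis
    using assms by simp
qed

lemma inverse_square_shift_integral: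
  fixes A :: real
  assumes "A > 0"
  shows "set_integrable lborel {0<..} (\<lambda>r. A / (r + A)\<^sup>2)"
    and "(LINT r:{0<..}|lborel. A / (r + A)\<^sup>2) = 1"
proof -
  have "(\<integral>\<^sup>+(r::real). ennreal (indicator {0<..} r *\<^sub>R (A / (r + A)\<^sup>2)) \<partial>lborel)
      = (\<integral>\<^sup>+(r::real). ennreal (A / (r + A)\<^sup>2) * indicator {0..} r \<partial>lborel)"
    using AE_lborel_singleton[of "0::real"]
    by (intro nn_integral_cong_AE) (auto split: split_indicator)
  then have "has_bochner_integral lborel (\<lambda>r. indicator {0<..} r *\<^sub>R (A / (r + A)\<^sup>2)) 1"
    using assms nn_integral_inverse_square_shift[OF assms]
    by (intro has_bochner_integral_nn_integral) (auto split: split_indicator)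
  then show "set_integrable lborel {0<..} (\<lambda>r. A / (r + A)\<^sup>2)"
    and "(LINT r:{0<..}|lborel. A / (r + A)\<^sup>2) = 1"
    by (auto simp: has_bochner_integral_iff set_integrable_def set_lebesgue_integral_def)
qed

lemma power_kernel_integrable:
  assumes "a \<notin> \<real>\<^sub>\<le>\<^sub>0"
  shows "set_integrable lborel {0<..} (\<lambda>r. cis (t * ln r) * (a / (complex_of_real r + a)\<^sup>2))"
proof -
  obtain c where c: "c > 0" "\<And>r. r \<ge> 0 \<Longrightarrow> c * (r + 1) \<le> norm (complex_of_real r + a)"
    using norm_add_lower_bound[OF assms] by blast
  have "set_integrable lborel {0<..} (\<lambda>r. (norm a / c\<^sup>2) * (1 / (r + 1)\<^sup>2))"
    by (intro set_integrable_mult_right inverse_square_shift_integral(1) zero_less_one)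
  then show ?thesis
  proof (rule set_integrable_bound)
    show "set_borel_measurable lborel {0<..}
        (\<lambda>r. cis (t * ln r) * (a / (complex_of_real r + a)\<^sup>2))"
      unfolding set_borel_measurable_def by measurable
    have "norm (cis (t * ln r) * (a / (complex_of_real r + a)\<^sup>2)) \<le>
        norm (norm a / c\<^sup>2 * (1 / (r + 1)\<^sup>2))" if r: "r > 0" for r
    proof -
      have "(c * (r + 1))\<^sup>2 \<le> (norm (complex_of_real r + a))\<^sup>2"
        using c r by (intro power_mono) auto
      then have "norm a / (norm (complex_of_real r + a))\<^sup>2 \<le> norm a / (c * (r + 1))\<^sup>2"
      proof (rule divide_left_mono)
        have "0 < (c * (r + 1))\<^sup>2"
          using c(1) r by simp
        then show "0 < (norm (complex_of_real r + a))\<^sup>2 * (c * (r + 1))\<^sup>2"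
          using \<open>(c * (r + 1))\<^sup>2 \<le> (norm (complex_of_real r + a))\<^sup>2\<close> by (intro mult_pos_pos) linarith+
      qed simp
      then show ?thesis
        using r by (simp add: norm_mult norm_divide norm_power power_mult_distrib)
    qed
    then show "AE r in lborel. r \<in> {0<..} \<longrightarrow>
        norm (cis (t * ln r) * (a / (complex_of_real r + a)\<^sup>2)) \<le>
        norm (norm a / c\<^sup>2 * (1 / (r + 1)\<^sup>2))"
      by simp
  qed
qed

text \<open>
  Differentiation under the integral sign. The difference quotient of \<open>a / (r + a)\<^sup>2\<close> is
  \<open>(r\<^sup>2 - a b) / ((r + a)\<^sup>2 (r + b)\<^sup>2)\<close>, which is dominated by a multiple of \<open>1 / (r + 1)\<^sup>2\<close> uniformly
  for \<open>b\<close> near \<open>a\<close>.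
\<close>
lemma power_kernel_integral_has_derivative:
  assumes "a \<notin> \<real>\<^sub>\<le>\<^sub>0"
  shows "(power_kernel_integral t has_field_derivative
    (LINT r:{0<..}|lborel. cis (t * ln r) *
       (((complex_of_real r)\<^sup>2 - a * a) / ((complex_of_real r + a)\<^sup>2 * (complex_of_real r + a)\<^sup>2)))) (at a)"
    (is "(_ has_field_derivative ?D) _")
  unfolding has_field_derivative_iff tendsto_at_iff_sequentially
proof (intro allI impI)
  define k where "k = (\<lambda>b r. cis (t * ln r) *
       (((complex_of_real r)\<^sup>2 - a * b) / ((complex_of_real r + a)\<^sup>2 * (complex_of_real r + b)\<^sup>2)))"
  fix X :: "nat \<Rightarrow> complex"
  assume X: "\<forall>i. X i \<in> UNIV - {a}" "X \<longlonglongrightarrow> a"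
  obtain c where c: "c > 0" "\<And>r. r \<ge> 0 \<Longrightarrow> c * (r + 1) \<le> norm (complex_of_real r + a)"
    using norm_add_lower_bound[OF assms] by blast
  have near: "c / 2 * (r + 1) \<le> norm (complex_of_real r + b)"
    if b: "norm (b - a) < c / 2" and r: "r \<ge> 0" for b r
  proof -
    have "norm (complex_of_real r + a) = norm ((complex_of_real r + b) - (b - a))"
      by simp
    also have "\<dots> \<le> norm (complex_of_real r + b) + norm (b - a)"
      by (rule norm_triangle_ineq4)
    finally have "c * (r + 1) - c / 2 \<le> norm (complex_of_real r + b)"
      using c(2)[OF r] b by linarith
    moreover have "c / 2 * (r + 1) \<le> c * (r + 1) - c / 2"
      using c(1) r by (simp add: field_simps)
    ultimately show ?thesis by linarith
  qed
  have near_nonpos: "b \<notin> \<real>\<^sub>\<le>\<^sub>0" if "norm (b - a) < c / 2" for b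
  proof
    assume "b \<in> \<real>\<^sub>\<le>\<^sub>0"
    then have "b = - complex_of_real (- Re b)" "Re b \<le> 0"
      by (auto simp: complex_nonpos_Reals_iff complex_eq_iff)
    moreover then have "0 < norm (complex_of_real (- Re b) + b)"
      using near[OF that, of "- Re b"] c(1)
      by (smt (verit, ccfv_threshold) half_gt_zero zero_less_mult_iff)
    ultimately show False by simp
  qed
  obtain N where N: "\<And>n. n \<ge> N \<Longrightarrow> norm (X n - a) < c / 2"
    using LIMSEQ_D[OF X(2), of "c / 2"] c(1) by auto
  define K where "K = 1 + norm a * (norm a + c / 2)"
  define W where "W = (\<lambda>r::real. 4 * K / c ^ 4 * (1 / (r + 1)\<^sup>2))"
  have quotient: "(power_kernel_integral t b - power_kernel_integral t a) / (b - a)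
      = (LINT r:{0<..}|lborel. k b r)" if b: "norm (b - a) < c / 2" "b \<noteq> a" for b
  proof -
    have "power_kernel_integral t b - power_kernel_integral t a =
      (LINT r:{0<..}|lborel. cis (t * ln r) * (b / (complex_of_real r + b)\<^sup>2) -
         cis (t * ln r) * (a / (complex_of_real r + a)\<^sup>2))"
      unfolding power_kernel_integral_def
      using power_kernel_integrable[OF near_nonpos[OF b(1)]] power_kernel_integrable[OF assms]
      by (simp add: set_integral_diff)
    also have "\<dots> = (LINT r:{0<..}|lborel. (b - a) * k b r)"
    proof (rule set_lebesgue_integral_cong)
      show "\<forall>r. r \<in> {0<..} \<longrightarrow> cis (t * ln r) * (b / (complex_of_real r + b)\<^sup>2) -
         cis (t * ln r) * (a / (complex_of_real r + a)\<^sup>2) = (b - a) * k b r"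
      proof (intro allI impI)
        fix r :: real assume "r \<in> {0<..}"
        then have "0 < c * (r + 1)" "r \<ge> 0"
          using c(1) by auto
        then have nz: "complex_of_real r + a \<noteq> 0" "complex_of_real r + b \<noteq> 0"
          using near[OF b(1), of r] c(2)[of r] by auto
        have "b / (complex_of_real r + b)\<^sup>2 - a / (complex_of_real r + a)\<^sup>2
          = (b - a) * (((complex_of_real r)\<^sup>2 - a * b) /
              ((complex_of_real r + a)\<^sup>2 * (complex_of_real r + b)\<^sup>2))"
        proof -
          have "b * (complex_of_real r + a)\<^sup>2 - a * (complex_of_real r + b)\<^sup>2
              = (b - a) * ((complex_of_real r)\<^sup>2 - a * b)"
            by (simp add: power2_eq_square algebra_simps)
          moreover have "b / (complex_of_real r + b)\<^sup>2 - a / (complex_of_real r + a)\<^sup>2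
              = (b * (complex_of_real r + a)\<^sup>2 - a * (complex_of_real r + b)\<^sup>2) /
                ((complex_of_real r + b)\<^sup>2 * (complex_of_real r + a)\<^sup>2)"
            by (rule diff_frac_eq) (use nz in auto)
          ultimately show ?thesis
            by (simp only: mult.commute[of "(complex_of_real r + b)\<^sup>2"] times_divide_eq_right)
        qed
        moreover have "cis (t * ln r) * (b / (complex_of_real r + b)\<^sup>2) -
              cis (t * ln r) * (a / (complex_of_real r + a)\<^sup>2) =
            cis (t * ln r) * (b / (complex_of_real r + b)\<^sup>2 - a / (complex_of_real r + a)\<^sup>2)"
          by (simp only: right_diff_distrib)
        ultimately show "cis (t * ln r) * (b / (complex_of_real r + b)\<^sup>2) -
         cis (t * ln r) * (a / (complex_of_real r + a)\<^sup>2) = (b - a) * k b r"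
          unfolding k_def by (simp only: mult.left_commute)
      qed
    qed simp
    also have "\<dots> = (b - a) * (LINT r:{0<..}|lborel. k b r)"
      by (rule set_integral_mult_right)
    finally show ?thesis
      using b(2) by simp
  qed
  have lim: "(\<lambda>n. LINT r:{0<..}|lborel. k (X (n + N)) r) \<longlonglongrightarrow> (LINT r:{0<..}|lborel. k a r)"
    unfolding set_lebesgue_integral_def
  proof (rule integral_dominated_convergence)
    show "integrable lborel (\<lambda>r. indicator {0<..} r *\<^sub>R W r)"
      unfolding W_def set_integrable_def[symmetric]
      by (intro set_integrable_mult_right inverse_square_shift_integral(1) zero_less_one)
    show "AE r in lborel. (\<lambda>n. indicator {0<..} r *\<^sub>R k (X (n + N)) r)
        \<longlonglongrightarrow> indicator {0<..} r *\<^sub>R k a r"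
    proof (rule AE_I2)
      fix r :: real
      show "(\<lambda>n. indicator {0<..} r *\<^sub>R k (X (n + N)) r) \<longlonglongrightarrow> indicator {0<..} r *\<^sub>R k a r"
      proof (cases "r > 0")
        case True
        then have "0 < c * (r + 1)" "r \<ge> 0"
          using c(1) by auto
        then have "complex_of_real r + a \<noteq> 0"
          using c(2)[of r] by auto
        then show ?thesis
          unfolding k_def using LIMSEQ_ignore_initial_segment[OF X(2), of N]
          by (intro tendsto_intros) auto
      qed simp
    qed
    show "AE r in lborel. norm (indicator {0<..} r *\<^sub>R k (X (n + N)) r) \<le> indicator {0<..} r *\<^sub>R W r" for n
    proof (rule AE_I2)
      fix r :: real
      show "norm (indicator {0<..} r *\<^sub>R k (X (n + N)) r) \<le> indicator {0<..} r *\<^sub>R W r"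
      proof (cases "r > 0")
        case True
        define b where "b = X (n + N)"
        have b: "norm (b - a) < c / 2"
          using N[of "n + N"] by (simp add: b_def)
        have "norm b \<le> norm a + c / 2"
          using b norm_triangle_sub[of b a] by linarith
        then have "norm (a * b) \<le> norm a * (norm a + c / 2)"
          by (simp add: norm_mult mult_left_mono)
        then have "norm ((complex_of_real r)\<^sup>2 - a * b) \<le> r\<^sup>2 + norm a * (norm a + c / 2)"
          using norm_triangle_ineq4[of "(complex_of_real r)\<^sup>2" "a * b"]
          by (simp add: norm_power)
        also have "\<dots> \<le> K * (r + 1)\<^sup>2"
        proof -
          have "1 * r\<^sup>2 \<le> 1 * (r + 1)\<^sup>2"
            using True by (intro mult_left_mono power_mono) auto
          moreover have "norm a * (norm a + c / 2) * 1 \<le> norm a * (norm a + c / 2) * (r + 1)\<^sup>2"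
            using True c(1) by (intro mult_left_mono) (auto simp: one_le_power)
          ultimately show ?thesis
            unfolding K_def distrib_right by linarith
        qed
        finally have num: "norm ((complex_of_real r)\<^sup>2 - a * b) \<le> K * (r + 1)\<^sup>2" .
        have den: "(c * (r + 1))\<^sup>2 * (c / 2 * (r + 1))\<^sup>2 \<le>
            norm ((complex_of_real r + a)\<^sup>2 * (complex_of_real r + b)\<^sup>2)"
          unfolding norm_mult norm_power
          using c near[OF b] True by (intro mult_mono power_mono) auto
        have "norm (k b r) = norm ((complex_of_real r)\<^sup>2 - a * b) /
            norm ((complex_of_real r + a)\<^sup>2 * (complex_of_real r + b)\<^sup>2)"
          by (simp add: k_def norm_mult norm_divide)
        also have "\<dots> \<le> K * (r + 1)\<^sup>2 / ((c * (r + 1))\<^sup>2 * (c / 2 * (r + 1))\<^sup>2)"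
          using num den c(1) True order_trans[OF norm_ge_zero num] by (intro frac_le) auto
        also have "\<dots> = W r"
        proof -
          have "(c * s)\<^sup>2 * (c / 2 * s)\<^sup>2 = (c ^ 4 / 4 * s\<^sup>2) * s\<^sup>2" for s :: real
            by (simp add: power2_eq_square power4_eq_xxxx)
          then have "K * s\<^sup>2 / ((c * s)\<^sup>2 * (c / 2 * s)\<^sup>2) = 4 * K / c ^ 4 * (1 / s\<^sup>2)" if "s > 0" for s
            using that c(1) by (simp only:) simp
          from this[of "r + 1"] show ?thesis
            using True unfolding W_def by linarith
        qed
        finally show ?thesis
          using True by (simp add: b_def)
      qed simp
    qed
  qed (unfold k_def, measurable)
  have "(\<lambda>n. (power_kernel_integral t (X (n + N)) - power_kernel_integral t a) / (X (n + N) - a))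
      = (\<lambda>n. LINT r:{0<..}|lborel. k (X (n + N)) r)"
    using quotient N X(1) by auto
  then have "(\<lambda>n. (power_kernel_integral t (X (n + N)) - power_kernel_integral t a) / (X (n + N) - a))
      \<longlonglongrightarrow> ?D"
    using lim by (simp add: k_def)
  then show "((\<lambda>y. (power_kernel_integral t y - power_kernel_integral t a) / (y - a)) \<circ> X) \<longlonglongrightarrow> ?D"
    unfolding o_def by (rule LIMSEQ_offset)
qed

text \<open>
  The kernel \<open>a / (r + a)\<^sup>2\<close> is homogeneous of degree \<open>- 1\<close> in \<open>(r, a)\<close>; substitute \<open>r = b r'\<close>.
\<close>
lemma power_kernel_integral_scale:
  assumes "b > 0"
  shows "power_kernel_integral t (complex_of_real b * a) = cis (t * ln b) * power_kernel_integral t a"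
proof -
  have "power_kernel_integral t (complex_of_real b * a) = \<bar>b\<bar> *\<^sub>R (LINT r|lborel.
      indicator {0<..} (0 + b * r) *\<^sub>R (cis (t * ln (0 + b * r)) *
        (complex_of_real b * a / (complex_of_real (0 + b * r) + complex_of_real b * a)\<^sup>2)))"
    unfolding power_kernel_integral_def set_lebesgue_integral_def
    by (rule lborel_integral_real_affine) (use assms in auto)
  also have "\<dots> = (LINT r|lborel. \<bar>b\<bar> *\<^sub>R (indicator {0<..} (0 + b * r) *\<^sub>R (cis (t * ln (0 + b * r)) *
        (complex_of_real b * a / (complex_of_real (0 + b * r) + complex_of_real b * a)\<^sup>2))))"
    by (rule integral_scaleR_right[symmetric]) 
  also have "\<dots> = (LINT r|lborel. cis (t * ln b) *
      (indicator {0<..} r *\<^sub>R (cis (t * ln r) * (a / (complex_of_real r + a)\<^sup>2))))"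
  proof (rule Bochner_Integration.integral_cong[OF refl])
    fix r :: real
    show "\<bar>b\<bar> *\<^sub>R (indicator {0<..} (0 + b * r) *\<^sub>R (cis (t * ln (0 + b * r)) *
        (complex_of_real b * a / (complex_of_real (0 + b * r) + complex_of_real b * a)\<^sup>2))) =
      cis (t * ln b) * (indicator {0<..} r *\<^sub>R (cis (t * ln r) * (a / (complex_of_real r + a)\<^sup>2)))"
    proof (cases "r > 0")
      case True
      have "complex_of_real (b * r) + complex_of_real b * a = complex_of_real b * (complex_of_real r + a)"
        by (simp add: algebra_simps)
      then have "complex_of_real b * (complex_of_real b * a / (complex_of_real (b * r) + complex_of_real b * a)\<^sup>2)
          = a / (complex_of_real r + a)\<^sup>2"
        using assms by (simp only: power_mult_distrib) (simp add: power2_eq_square)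
      moreover have "cis (t * ln (b * r)) = cis (t * ln b) * cis (t * ln r)"
        using True assms by (simp add: ln_mult_pos cis_mult distrib_left)
      ultimately have "complex_of_real b * (cis (t * ln (b * r)) *
          (complex_of_real b * a / (complex_of_real (b * r) + complex_of_real b * a)\<^sup>2)) =
        cis (t * ln b) * (cis (t * ln r) * (a / (complex_of_real r + a)\<^sup>2))"
        by (simp only: mult.left_commute[of "complex_of_real b"] mult.assoc)
      then show ?thesis
        using True assms by (simp add: scaleR_conv_of_real)
    qed (use assms in \<open>auto simp: zero_less_mult_iff\<close>)
  qed
  also have "\<dots> = cis (t * ln b) * power_kernel_integral t a"
    unfolding power_kernel_integral_def set_lebesgue_integral_def by (rule integral_mult_right_zero)
  finally show ?thesis .
qed

text \<open>
  By homogeneity both sides agree for \<open>a > 0\<close>, and both are holomorphic on the slit plane. This is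
  where arguments of complex numbers become exponential factors: on the ray at angle \<open>\<theta>\<close> the factor
  is \<open>exp (- t \<theta>)\<close>.
\<close>
lemma power_kernel_integral_eq:
  assumes "a \<notin> \<real>\<^sub>\<le>\<^sub>0"
  shows "power_kernel_integral t a = exp (\<i> * complex_of_real t * Ln a) * power_kernel_integral t 1"
proof -
  define g where "g = (\<lambda>a. power_kernel_integral t a - exp (\<i> * complex_of_real t * Ln a) * power_kernel_integral t 1)"
  define S :: "complex set" where "S = - \<real>\<^sub>\<le>\<^sub>0"
  have S: "S = - (complex_of_real ` {..0})"
    unfolding S_def by (auto simp: nonpos_Reals_def)
  have "g a = 0"
  proof (rule analytic_continuation[where f = g and S = S and U = "complex_of_real ` {0<..}" and \<xi> = 1])
    show "g holomorphic_on S"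
      unfolding g_def
    proof (intro holomorphic_intros)
      show "power_kernel_integral t holomorphic_on S"
        using power_kernel_integral_has_derivative
        by (auto simp: S_def holomorphic_on_def field_differentiable_def
            intro: has_field_derivative_at_within)
    qed (auto simp: S_def)
    show "open S"
      by (simp add: S_def open_Compl)
    show "connected S"
      unfolding S using starlike_slotted_complex_plane_left starlike_imp_connected by blast
    show "complex_of_real ` {0<..} \<subseteq> S" "1 \<in> S"
      by (auto simp: S_def complex_nonpos_Reals_iff)
    show "1 islimpt complex_of_real ` {0<..}"
      unfolding islimpt_sequential
    proof (intro exI conjI allI)
      show "(\<lambda>n. complex_of_real (1 + inverse (real (Suc n)))) \<longlonglongrightarrow> 1"
        using tendsto_of_real[OF LIMSEQ_inverse_real_of_nat_add[of 1], where 'a = complex] by simp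
      show "complex_of_real (1 + inverse (real (Suc n))) \<in> complex_of_real ` {0<..} - {1}" for n
    proof -
      have "1 + inverse (real (Suc n)) > 1" by simp
      then have "complex_of_real (1 + inverse (real (Suc n))) \<noteq> 1"
        using of_real_eq_1_iff by (metis less_irrefl)
      moreover have "1 + inverse (real (Suc n)) \<in> {0<..}"
        by (simp add: add_pos_pos del: of_nat_Suc)
      ultimately show ?thesis
        by (intro DiffI imageI) (simp_all only: singleton_iff not_False_eq_True)
    qed
    qed
    show "g z = 0" if "z \<in> complex_of_real ` {0<..}" for z
    proof -
      obtain b where b: "z = complex_of_real b" "b > 0"
        using \<open>z \<in> complex_of_real ` {0<..}\<close> by auto
      have "exp (\<i> * complex_of_real t * Ln z) = cis (t * ln b)"
        using b by (simp add: cis_conv_exp Ln_of_real mult_ac)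
      then show ?thesis
        using power_kernel_integral_scale[of b t 1] b by (simp add: g_def)
    qed
    show "a \<in> S"
      using assms by (simp add: S_def)
  qed
  then show ?thesis
    by (simp add: g_def)
qed

text \<open>
  Euler's integral for \<open>\<Gamma> (1 + i t)\<close>, rescaled.
\<close>
lemma gamma_integral_cis:
  fixes t u :: real
  assumes "u > 0"
  shows "set_integrable lborel {0<..} (\<lambda>r. cis (t * ln r) * complex_of_real (exp (- (u * r))))"
    and "(LINT r:{0<..}|lborel. cis (t * ln r) * complex_of_real (exp (- (u * r)))) =
      Gamma (1 + \<i> * complex_of_real t) * cis (- t * ln u) / complex_of_real u"
proof -
  define f where "f = (\<lambda>r. cis (t * ln r) * complex_of_real (exp (- r)))"
  have f_eq: "complex_of_real r powr ((1 + \<i> * complex_of_real t) - 1) / complex_of_real (exp r) = f r"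
    if "r \<in> {0<..}" for r
    using that by (simp add: f_def powr_def cis_conv_exp Ln_of_real exp_minus field_simps)
  have "f absolutely_integrable_on {0<..}"
    using absolutely_integrable_Gamma_integral'[of "1 + \<i> * complex_of_real t"]
    unfolding set_integrable_def
    by (rule Bochner_Integration.integrable_cong[THEN iffD1, rotated 2])
       (use f_eq in \<open>auto simp del: add_diff_cancel_left' split: split_indicator\<close>)
  then have int: "set_integrable lborel {0<..} f"
    unfolding set_integrable_def f_def by (subst (asm) integrable_completion) measurable
  have "(f has_integral Gamma (1 + \<i> * complex_of_real t)) {0<..}"
    by (rule has_integral_eq[OF f_eq Gamma_integral_complex']) simp_all
  then have val: "(LINT r:{0<..}|lborel. f r) = Gamma (1 + \<i> * complex_of_real t)"
    using set_borel_integral_eq_integral(2)[OF int] by (simp add: integral_unique)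
  have scaled: "indicator {0<..} (0 + u * r) *\<^sub>R f (0 + u * r) = cis (t * ln u) *
     (indicator {0<..} r *\<^sub>R (cis (t * ln r) * complex_of_real (exp (- (u * r)))))" for r
    using assms by (cases "r > 0")
      (auto simp: f_def ln_mult_pos distrib_left zero_less_mult_iff simp flip: cis_mult)
  have unit: "cis (- t * ln u) * (cis (t * ln u) * z) = z" for z
    by (simp add: mult.assoc[symmetric] cis_mult)
  have "integrable lborel (\<lambda>r. cis (- t * ln u) * (indicator {0<..} (0 + u * r) *\<^sub>R f (0 + u * r)))"
    using int assms unfolding set_integrable_def
    by (intro integrable_mult_right lborel_integrable_real_affine) auto
  then show "set_integrable lborel {0<..} (\<lambda>r. cis (t * ln r) * complex_of_real (exp (- (u * r))))"
    unfolding scaled unit set_integrable_def .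
  have "Gamma (1 + \<i> * complex_of_real t) =
      \<bar>u\<bar> *\<^sub>R (LINT r|lborel. indicator {0<..} (0 + u * r) *\<^sub>R f (0 + u * r))"
    unfolding val[symmetric] set_lebesgue_integral_def
    by (rule lborel_integral_real_affine) (use assms in auto)
  also have "\<dots> = complex_of_real u * (cis (t * ln u) *
     (LINT r:{0<..}|lborel. cis (t * ln r) * complex_of_real (exp (- (u * r)))))"
    unfolding scaled set_lebesgue_integral_def
    by (subst integral_mult_right_zero) (use assms in \<open>simp add: scaleR_conv_of_real\<close>)
  finally have "cis (- t * ln u) * Gamma (1 + \<i> * complex_of_real t) / complex_of_real u = 
     (LINT r:{0<..}|lborel. cis (t * ln r) * complex_of_real (exp (- (u * r))))"
    using assms unit[of "LINT r:{0<..}|lborel. cis (t * ln r) * complex_of_real (exp (- (u * r)))"]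
    by (simp add: mult_ac)
  then show "(LINT r:{0<..}|lborel. cis (t * ln r) * complex_of_real (exp (- (u * r)))) =
      Gamma (1 + \<i> * complex_of_real t) * cis (- t * ln u) / complex_of_real u"
    by (simp add: mult_ac)
qed

lemma integral_exp_weight:
  fixes s :: real
  assumes "s > 0"
  shows "set_integrable lborel {0<..} (\<lambda>u. u * exp (- (s * u)))"
    and "(LINT u:{0<..}|lborel. u * exp (- (s * u))) = 1 / s\<^sup>2"
proof -
  have "(\<integral>\<^sup>+(u::real). ennreal (u * exp (- (s * u))) * indicator {0..} u \<partial>lborel)
     = 0 - (- (0 / s + 1 / s\<^sup>2) * exp (- (s * 0)))"
  proof (rule nn_integral_FTC_atLeast)
    show "((\<lambda>u. - (u / s + 1 / s\<^sup>2) * exp (- (s * u))) has_real_derivative u * exp (- (s * u))) (at u)" for u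
      using assms by (auto intro!: derivative_eq_intros simp: power2_eq_square field_simps)
    show "((\<lambda>u. - (u / s + 1 / s\<^sup>2) * exp (- (s * u))) \<longlongrightarrow> 0) at_top"
      using assms by real_asymp
  qed auto
  moreover have "(\<integral>\<^sup>+(u::real). ennreal (indicator {0<..} u *\<^sub>R (u * exp (- (s * u)))) \<partial>lborel)
      = (\<integral>\<^sup>+u. ennreal (u * exp (- (s * u))) * indicator {0..} u \<partial>lborel)"
    using AE_lborel_singleton[of "0::real"]
    by (intro nn_integral_cong_AE) (auto split: split_indicator)
  ultimately have "has_bochner_integral lborel (\<lambda>u. indicator {0<..} u *\<^sub>R (u * exp (- (s * u)))) (1 / s\<^sup>2)"
    using assms by (intro has_bochner_integral_nn_integral) (auto split: split_indicator)
  then show "set_integrable lborel {0<..} (\<lambda>u. u * exp (- (s * u)))"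
    and "(LINT u:{0<..}|lborel. u * exp (- (s * u))) = 1 / s\<^sup>2"
    by (auto simp: has_bochner_integral_iff set_integrable_def set_lebesgue_integral_def)
qed

text \<open>
  Write \<open>1 / (r + 1)\<^sup>2\<close> as the Laplace integral of \<open>u exp (- (r + 1) u)\<close> over \<open>u > 0\<close> and exchange the
  order of integration: each variable then contributes one Gamma integral.
\<close>
lemma power_kernel_integral_1:
  "power_kernel_integral t 1 = Gamma (1 + \<i> * complex_of_real t) * Gamma (1 - \<i> * complex_of_real t)"
proof -
  define g where "g = (\<lambda>r u. (indicator {0<..} r * indicator {0<..} u * u * exp (- ((r + 1) * u))) *\<^sub>R cis (t * ln r))"
  have norm_g: "norm (g r u) = indicator {0<..} r *\<^sub>R (indicator {0<..} u *\<^sub>R (u * exp (- ((r + 1) * u))))" for r u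
    by (auto simp: g_def split: split_indicator)
  have g_slice: "g r u = (indicator {0<..} r *\<^sub>R cis (t * ln r)) *
      complex_of_real (indicator {0<..} u *\<^sub>R (u * exp (- ((r + 1) * u))))" for r u
    by (simp add: g_def scaleR_conv_of_real mult_ac)
  have int_norm: "(LINT u|lborel. norm (g r u)) = indicator {0<..} r *\<^sub>R (1 / (r + 1)\<^sup>2)" for r
    using integral_exp_weight(2)[of "r + 1"]
    unfolding norm_g integral_scaleR_right set_lebesgue_integral_def
    by (auto split: split_indicator)
  have slice_integrable: "integrable lborel (g r)" for r
  proof (cases "r > 0")
    case True
    then have "integrable lborel (\<lambda>u. complex_of_real (indicator {0<..} u *\<^sub>R (u * exp (- ((r + 1) * u)))))"
      using integral_exp_weight(1)[of "r + 1"] unfolding set_integrable_def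
      by (intro integrable_of_real) auto
    then show ?thesis
      unfolding g_slice by (intro integrable_mult_right)
  qed (simp add: g_def)
  have "integrable (lborel \<Otimes>\<^sub>M lborel) (case_prod g)"
  proof (rule lborel_pair.Fubini_integrable)
    show "integrable lborel (\<lambda>r. LINT u|lborel. norm (case_prod g (r, u)))"
      using inverse_square_shift_integral(1)[OF zero_less_one]
      by (simp add: int_norm set_integrable_def)
    show "AE r in lborel. integrable lborel (\<lambda>u. case_prod g (r, u))"
      by (simp add: slice_integrable)
    show "case_prod g \<in> borel_measurable (lborel \<Otimes>\<^sub>M lborel)"
      unfolding g_def by measurable
  qed
  then have "(LINT u|lborel. LINT r|lborel. g r u) = (LINT r|lborel. LINT u|lborel. g r u)"
    by (rule lborel_pair.Fubini_integral)
  moreover have "(LINT r|lborel. LINT u|lborel. g r u) = power_kernel_integral t 1"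
  proof -
    have "(LINT u|lborel. g r u) = indicator {0<..} r *\<^sub>R (cis (t * ln r) * (1 / (complex_of_real r + 1)\<^sup>2))" for r
    proof (cases "r > 0")
      case True
      then have "(LINT u|lborel. complex_of_real (indicator {0<..} u *\<^sub>R (u * exp (- ((r + 1) * u)))))
          = complex_of_real (1 / (r + 1)\<^sup>2)"
        using integral_exp_weight(2)[of "r + 1"]
        unfolding set_lebesgue_integral_def integral_complex_of_real by simp
      then show ?thesis
        using True unfolding g_slice integral_mult_right_zero by simp
    qed (simp add: g_def)
    then show ?thesis
      by (simp add: power_kernel_integral_def set_lebesgue_integral_def)
  qed
  moreover have "(LINT u|lborel. LINT r|lborel. g r u) =
      Gamma (1 + \<i> * complex_of_real t) * Gamma (1 - \<i> * complex_of_real t)"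
  proof -
    have "(LINT r|lborel. g r u) = Gamma (1 + \<i> * complex_of_real t) *
        (indicator {0<..} u *\<^sub>R (cis (- t * ln u) * complex_of_real (exp (- (1 * u)))))" for u
    proof (cases "u > 0")
      case True
      have "g r u = complex_of_real (u * exp (- u)) *
          (indicator {0<..} r *\<^sub>R (cis (t * ln r) * complex_of_real (exp (- (u * r)))))" for r
      proof -
        have "exp (- ((r + 1) * u)) = exp (- u) * exp (- (u * r))"
          by (simp add: exp_add[symmetric] algebra_simps)
        then show ?thesis
          using True by (simp add: g_def scaleR_conv_of_real)
      qed
      then have "(LINT r|lborel. g r u) = complex_of_real (u * exp (- u)) *
          (Gamma (1 + \<i> * complex_of_real t) * cis (- t * ln u) / complex_of_real u)"
        unfolding gamma_integral_cis(2)[OF True, of t, symmetric] set_lebesgue_integral_def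
        by (simp only: integral_mult_right_zero)
      then show ?thesis
        using True by (simp add: field_simps)
    qed (simp add: g_def)
    then have "(LINT u|lborel. LINT r|lborel. g r u) = Gamma (1 + \<i> * complex_of_real t) *
        (LINT u:{0<..}|lborel. cis (- t * ln u) * complex_of_real (exp (- (1 * u))))"
      unfolding set_lebesgue_integral_def by (simp only: integral_mult_right_zero)
    then show ?thesis
      unfolding gamma_integral_cis(2)[OF zero_less_one, of "- t"] by simp
  qed
  ultimately show ?thesis by simp
qed

text \<open>
  This non-vanishing is what allows the Mellin transform of a law to be recovered from that of its
  averaged kernel.
\<close>
lemma power_kernel_integral_1_nonzero: "power_kernel_integral t 1 \<noteq> 0"
  unfolding power_kernel_integral_1
  by (simp only: mult_eq_0_iff Gamma_eq_zero_iff de_Morgan_disj)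
     (auto simp: nonpos_Ints_def complex_eq_iff)

section \<open>Averages of the kernel\<close>

text \<open>
  The Mellin transform of the part of \<open>\<mu>\<close> on a half-line (\<open>s = 1\<close> or \<open>s = - 1\<close>), on the imaginary
  axis. There it always converges, so no moment of \<open>\<mu>\<close> is required to exist.
\<close>
definition signed_mellin :: "real \<Rightarrow> real measure \<Rightarrow> real \<Rightarrow> complex" where
  "signed_mellin s \<mu> t = (LINT x|\<mu>. (if sgn x = s then cis (t * ln \<bar>x\<bar>) else 0))"

text \<open>
  Difference quotients along the fixed steps \<open>1 / (n + 1)\<close> suffice: only the fact that the slope is
  determined by \<open>p\<close> matters, so that laws sharing \<open>p\<close> share the slope.
\<close>
definition slope :: "(real \<Rightarrow> complex) \<Rightarrow> real \<Rightarrow> complex" where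
  "slope p r = lim (\<lambda>n. (p (r + inverse (real (Suc n))) - p r) * of_nat (Suc n))"

definition slope_mellin :: "(real \<Rightarrow> complex) \<Rightarrow> real \<Rightarrow> complex" where
  "slope_mellin p t = (LINT r:{0<..}|lborel. cis (t * ln r) * slope p r)"

text \<open>
  Along a ray the rescaled Cauchy transform \<open>z G(z)\<close> becomes an average of \<open>r / (r + a)\<close>, where \<open>a\<close> is
  a random complex number. The sector condition keeps \<open>a\<close> uniformly away from the negative half-line,
  relative to its size.
\<close>
locale bounded_stieltjes_average = prob_space \<mu> for \<mu> :: "'b measure" +
  fixes a :: "'b \<Rightarrow> complex" and c :: real
  assumes a_measurable [measurable]: "a \<in> borel_measurable \<mu>"
    and c_pos: "c > 0"
    and a_bound: "AE x in \<mu>. \<forall>r>0. c * (r + norm (a x)) \<le> norm (complex_of_real r + a x)"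
begin

text \<open>
  As \<open>r / (r + a)\<close> tends to \<open>1\<close> at infinity, its Mellin transform on the imaginary axis diverges. Its
  derivative \<open>a / (r + a)\<^sup>2\<close> is integrable in \<open>r\<close>, with a bound uniform in \<open>a\<close>, and is therefore used
  instead. It is taken under the expectation by dominated convergence.
\<close>
lemma slope_average:
  assumes r: "r > 0"
  shows "slope (\<lambda>r. LINT x|\<mu>. complex_of_real r / (complex_of_real r + a x)) r
    = (LINT x|\<mu>. a x / (complex_of_real r + a x)\<^sup>2)"
proof -
  define p where "p = (\<lambda>r. LINT x|\<mu>. complex_of_real r / (complex_of_real r + a x))"
  have far: "c * s \<le> norm (complex_of_real s + a x)"
    if "\<forall>r>0. c * (r + norm (a x)) \<le> norm (complex_of_real r + a x)" "s > 0" for s x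
    using that c_pos by (smt (verit) mult_left_mono norm_ge_zero)
  have integrable_p: "integrable \<mu> (\<lambda>x. complex_of_real s / (complex_of_real s + a x))" if "s > 0" for s
  proof (rule integrable_const_bound)
    show "AE x in \<mu>. norm (complex_of_real s / (complex_of_real s + a x)) \<le> 1 / c"
      using a_bound
    proof eventually_elim
      case (elim x)
      have "c * s \<le> norm (complex_of_real s + a x)" "0 < c * s"
        using far[OF elim \<open>s > 0\<close>] c_pos \<open>s > 0\<close> by auto
      then show ?case
        using c_pos \<open>s > 0\<close> by (simp add: norm_divide divide_simps mult.commute)
    qed
  qed measurable
  define k where "k = (\<lambda>s x. a x / ((complex_of_real r + a x) * (complex_of_real s + a x)))"
  define h where "h = (\<lambda>n. r + inverse (real (Suc n)))"
  have h: "h n > r" for n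
    by (simp add: h_def)
  have quotient: "(p (h n) - p r) * of_nat (Suc n) = (LINT x|\<mu>. k (h n) x)" for n
  proof -
    have "h n > 0" using h[of n] r by simp
    have "(p (h n) - p r) * of_nat (Suc n) = (LINT x|\<mu>. (complex_of_real (h n) / (complex_of_real (h n) + a x)
       - complex_of_real r / (complex_of_real r + a x)) * of_nat (Suc n))"
      using integrable_p[OF r] integrable_p[OF \<open>h n > 0\<close>] by (simp add: p_def)
    also have "\<dots> = (LINT x|\<mu>. k (h n) x)"
    proof (rule integral_cong_AE)
      show "AE x in \<mu>. (complex_of_real (h n) / (complex_of_real (h n) + a x)
         - complex_of_real r / (complex_of_real r + a x)) * of_nat (Suc n) = k (h n) x"
        using a_bound
      proof eventually_elim
        case (elim x)
        have "0 < c * r" "0 < c * h n"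
          using c_pos r \<open>h n > 0\<close> by auto
        then have nz: "complex_of_real r + a x \<noteq> 0" "complex_of_real (h n) + a x \<noteq> 0"
          using far[OF elim r] far[OF elim \<open>h n > 0\<close>] by auto
        have "complex_of_real (h n) / (complex_of_real (h n) + a x)
            - complex_of_real r / (complex_of_real r + a x)
          = (complex_of_real (h n) * (complex_of_real r + a x) - complex_of_real r * (complex_of_real (h n) + a x))
            / ((complex_of_real (h n) + a x) * (complex_of_real r + a x))"
          by (rule diff_frac_eq) (use nz in auto)
        also have "\<dots> = complex_of_real (h n - r) * k (h n) x"
          by (simp add: k_def algebra_simps)
        finally have eq: "complex_of_real (h n) / (complex_of_real (h n) + a x)
            - complex_of_real r / (complex_of_real r + a x) = complex_of_real (h n - r) * k (h n) x" .
        have "complex_of_real (h n - r) * of_nat (Suc n) = complex_of_real ((h n - r) * real (Suc n))"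
          by (simp only: of_real_mult of_real_of_nat_eq)
        also have "\<dots> = 1"
          by (simp add: h_def del: of_nat_Suc)
        finally have "k (h n) x * (complex_of_real (h n - r) * of_nat (Suc n)) = k (h n) x"
          by simp
        then show ?case
          unfolding eq by (simp only: mult_ac)
      qed
    qed (unfold k_def, measurable)
    finally show ?thesis .
  qed
  have "(\<lambda>n. LINT x|\<mu>. k (h n) x) \<longlonglongrightarrow> (LINT x|\<mu>. k r x)"
  proof (rule integral_dominated_convergence)
    show "integrable \<mu> (\<lambda>x. 1 / (c * (c * r)))" by simp
    show "AE x in \<mu>. (\<lambda>n. k (h n) x) \<longlonglongrightarrow> k r x"
      using a_bound
    proof eventually_elim
      case (elim x)
      have "0 < c * r" using c_pos r by auto
      then have nz: "complex_of_real r + a x \<noteq> 0"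
        using far[OF elim r] by auto
      have "h \<longlonglongrightarrow> r"
        unfolding h_def using LIMSEQ_inverse_real_of_nat_add[of r] by simp
      then show ?case
        unfolding k_def using nz by (intro tendsto_intros) auto
    qed
    show "AE x in \<mu>. norm (k (h n) x) \<le> 1 / (c * (c * r))" for n
      using a_bound
    proof eventually_elim
      case (elim x)
      have pos: "0 < c * r" "h n > 0" using c_pos r h[of n] by auto
      have 1: "c * norm (a x) \<le> norm (complex_of_real (h n) + a x)"
        using elim pos(2) c_pos by (smt (verit) mult_left_mono)
      have 2: "c * r \<le> norm (complex_of_real r + a x)"
        using far[OF elim r] .
      have 3: "0 < norm (complex_of_real (h n) + a x)"
        using far[OF elim pos(2)] c_pos pos(2) by (smt (verit) mult_pos_pos)
      have "norm (k (h n) x) = norm (a x) / norm (complex_of_real (h n) + a x) / norm (complex_of_real r + a x)"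
        by (simp add: k_def norm_divide norm_mult mult.commute)
      also have "\<dots> \<le> (1 / c) / (c * r)"
      proof (rule frac_le)
        show "norm (a x) / norm (complex_of_real (h n) + a x) \<le> 1 / c"
          using 1 3 c_pos by (simp add: pos_divide_le_eq pos_le_divide_eq mult.commute)
      qed (use 2 c_pos pos(1) in auto)
      finally show ?case by simp
    qed
  qed (unfold k_def, measurable)
  then have "(\<lambda>n. (p (h n) - p r) * of_nat (Suc n)) \<longlonglongrightarrow> (LINT x|\<mu>. a x / (complex_of_real r + a x)\<^sup>2)"
    unfolding quotient by (simp add: k_def power2_eq_square)
  then show ?thesis
    unfolding slope_def p_def[symmetric] h_def by (rule limI)
qed

text \<open>
  If \<open>a < 0\<close>, the sector condition fails at \<open>r = - a\<close>.
\<close>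
lemma AE_nonpos: "AE x in \<mu>. a x = 0 \<or> a x \<notin> \<real>\<^sub>\<le>\<^sub>0"
  using a_bound
proof eventually_elim
  case (elim x)
  show ?case
  proof (rule ccontr)
    assume "\<not> ?thesis"
    then have "a x \<noteq> 0" "a x = - complex_of_real (norm (a x))"
      by (auto elim!: nonpos_Reals_cases)
    then have "complex_of_real (norm (a x)) + a x = 0" "norm (a x) > 0"
      by (metis add.right_inverse, simp)
    with elim have "c * (norm (a x) + norm (a x)) \<le> 0"
      by (metis norm_zero)
    then show False
      using c_pos \<open>norm (a x) > 0\<close> by (simp add: mult_le_0_iff)
  qed
qed

text \<open>
  Fubini's theorem applies because \<open>\<bar>a\<bar> / (c (r + \<bar>a\<bar>))\<^sup>2\<close> has integral at most \<open>1 / c\<^sup>2\<close> in \<open>r\<close>, whatever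
  the value of \<open>a\<close>.
\<close>
lemma mellin_average:
  "(LINT r:{0<..}|lborel. cis (t * ln r) * (LINT x|\<mu>. a x / (complex_of_real r + a x)\<^sup>2))
    = power_kernel_integral t 1 * (LINT x|\<mu>. (if a x = 0 then 0 else exp (\<i> * complex_of_real t * Ln (a x))))"
proof -
  interpret P: pair_sigma_finite \<mu> "lborel :: real measure" ..
  define g where "g = (\<lambda>x r. indicator {0<..} r *\<^sub>R (cis (t * ln r) * (a x / (complex_of_real r + a x)\<^sup>2)))"
  define W where "W = (\<lambda>x r. 1 / c\<^sup>2 * (indicator {0<..} r *\<^sub>R (norm (a x) / (r + norm (a x))\<^sup>2)))"
  have g_measurable [measurable]: "case_prod g \<in> borel_measurable (\<mu> \<Otimes>\<^sub>M lborel)"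
    unfolding g_def by measurable
  have W: "integrable lborel (W x) \<and> (LINT r|lborel. W x r) \<le> 1 / c\<^sup>2" for x
  proof (cases "a x = 0")
    case False
    then have unit: "integrable lborel (\<lambda>r. indicator {0<..} r *\<^sub>R (norm (a x) / (r + norm (a x))\<^sup>2))"
        "(LINT r|lborel. indicator {0<..} r *\<^sub>R (norm (a x) / (r + norm (a x))\<^sup>2)) = 1"
      using inverse_square_shift_integral[of "norm (a x)"]
      unfolding set_integrable_def set_lebesgue_integral_def zero_less_norm_iff by blast+
    show ?thesis
      unfolding W_def integral_mult_right_zero unit(2) using unit(1) by (intro conjI integrable_mult_right) auto
  qed (use c_pos in \<open>simp add: W_def\<close>)
  have g_le_W: "AE x in \<mu>. \<forall>r. norm (g x r) \<le> W x r"
    using a_bound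
  proof eventually_elim
    case (elim x)
    show ?case
    proof
      fix r :: real
      show "norm (g x r) \<le> W x r"
      proof (cases "r > 0")
        case True
        have pos: "0 < c * (r + norm (a x))"
          using c_pos True by (intro mult_pos_pos add_pos_nonneg) auto
        have "norm (a x) / (norm (complex_of_real r + a x))\<^sup>2 \<le> norm (a x) / (c * (r + norm (a x)))\<^sup>2"
        proof (rule divide_left_mono)
          have le: "c * (r + norm (a x)) \<le> norm (complex_of_real r + a x)"
            using elim True by blast
          then show "(c * (r + norm (a x)))\<^sup>2 \<le> (norm (complex_of_real r + a x))\<^sup>2"
            using pos by (intro power_mono) auto
          have "0 < norm (complex_of_real r + a x)"
            using pos le by linarith
          then show "0 < (norm (complex_of_real r + a x))\<^sup>2 * (c * (r + norm (a x)))\<^sup>2"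
            using pos by (simp only: mult_pos_pos zero_less_power)
        qed simp
        then show ?thesis
          using True by (simp add: g_def W_def norm_mult norm_divide norm_power power_mult_distrib)
      qed (simp add: g_def W_def)
    qed
  qed
  have slice: "AE x in \<mu>. integrable lborel (g x)"
    using g_le_W
  proof eventually_elim
    case (elim x)
    show ?case
      by (rule Bochner_Integration.integrable_bound[OF conjunct1[OF W[of x]]])
         (use elim in \<open>auto simp: g_def intro: order_trans[OF _ abs_ge_self]\<close>)
  qed
  have "integrable (\<mu> \<Otimes>\<^sub>M lborel) (case_prod g)"
  proof (rule P.Fubini_integrable)
    show "integrable \<mu> (\<lambda>x. LINT r|lborel. norm (case_prod g (x, r)))"
    proof (rule integrable_const_bound)
      show "AE x in \<mu>. norm (LINT r|lborel. norm (case_prod g (x, r))) \<le> 1 / c\<^sup>2"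
        using g_le_W slice
      proof eventually_elim
        case (elim x)
        have "(LINT r|lborel. norm (g x r)) \<le> (LINT r|lborel. W x r)"
          using elim W[of x] by (intro integral_mono) auto
        moreover have "0 \<le> (LINT r|lborel. norm (g x r))"
          by (intro integral_nonneg_AE) auto
        ultimately show ?case
          using W[of x] by simp
      qed
    qed measurable
    show "AE x in \<mu>. integrable lborel (\<lambda>r. case_prod g (x, r))"
      using slice by simp
  qed simp
  then have "(LINT r|lborel. LINT x|\<mu>. g x r) = (LINT x|\<mu>. LINT r|lborel. g x r)"
    by (rule P.Fubini_integral)
  moreover have "(LINT x|\<mu>. g x r) = indicator {0<..} r *\<^sub>R (cis (t * ln r) * (LINT x|\<mu>. a x / (complex_of_real r + a x)\<^sup>2))" for r
    unfolding g_def by (simp only: integral_scaleR_right integral_mult_right_zero)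
  moreover have "(LINT x|\<mu>. LINT r|lborel. g x r) = (LINT x|\<mu>. power_kernel_integral t 1 *
      (if a x = 0 then 0 else exp (\<i> * complex_of_real t * Ln (a x))))"
  proof (rule integral_cong_AE)
    show "AE x in \<mu>. (LINT r|lborel. g x r) = power_kernel_integral t 1 *
      (if a x = 0 then 0 else exp (\<i> * complex_of_real t * Ln (a x)))"
      using AE_nonpos
    proof eventually_elim
      case (elim x)
      have "(LINT r|lborel. g x r) = power_kernel_integral t (a x)"
        unfolding g_def power_kernel_integral_def set_lebesgue_integral_def ..
      then show ?case
        using elim power_kernel_integral_eq[of "a x" t]
        by (auto simp: power_kernel_integral_def)
    qed
  qed measurable
  ultimately show ?thesis
    unfolding set_lebesgue_integral_def by simp
qed

text \<open>
  The left side depends on \<open>p\<close> alone, the right side is a power moment of \<open>a\<close>.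
\<close>
lemma slope_mellin_average:
  assumes "\<And>r. r > 0 \<Longrightarrow> (LINT x|\<mu>. complex_of_real r / (complex_of_real r + a x)) = p r"
  shows "slope_mellin p t =
    power_kernel_integral t 1 * (LINT x|\<mu>. (if a x = 0 then 0 else exp (\<i> * complex_of_real t * Ln (a x))))"
proof -
  have "slope p r = (LINT x|\<mu>. a x / (complex_of_real r + a x)\<^sup>2)" if "r > 0" for r
  proof -
    have eq: "p s = (LINT x|\<mu>. complex_of_real s / (complex_of_real s + a x))" if "s > 0" for s
      using assms[OF that] by (rule sym)
    have pos: "0 < r + inverse (real (Suc n))" for n
      using that by (simp add: add_pos_pos del: of_nat_Suc)
    show ?thesis
      unfolding slope_average[OF that, symmetric] slope_def
      by (simp only: eq[OF that] eq[OF pos])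
  qed
  then show ?thesis
    unfolding mellin_average[symmetric] slope_mellin_def
    by (intro set_lebesgue_integral_cong) auto
qed

end

section \<open>The trinomial equation for the Cauchy transform\<close>

lemma sin_mult_same_sign:
  assumes "0 < \<bar>\<phi>\<bar>" "\<bar>\<phi>\<bar> < pi" "0 < \<beta>" "\<beta> \<le> (1::real)"
  shows "0 < sin \<phi> * sin (\<beta> * \<phi>)"
proof -
  have "0 < sin \<bar>\<phi>\<bar>" "0 < sin (\<beta> * \<bar>\<phi>\<bar>)"
    using assms by (auto intro!: sin_gt_zero elim: le_less_trans[rotated] simp: mult_left_le_one_le)
  then have "0 < sin \<bar>\<phi>\<bar> * sin (\<beta> * \<bar>\<phi>\<bar>)"
    by simp
  then show ?thesis
    by (cases "\<phi> < 0") auto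
qed

lemma polar_powr:
  assumes "u \<noteq> (0::complex)"
  shows "u = complex_of_real (norm u) * cis (Im (Ln u))"
    and "u powr complex_of_real \<alpha> = complex_of_real (norm u powr \<alpha>) * cis (\<alpha> * Im (Ln u))"
proof -
  have Ln: "Ln u = complex_of_real (ln (norm u)) + \<i> * complex_of_real (Im (Ln u))"
    using assms by (simp add: complex_eq_iff)
  have "u = exp (Ln u)"
    using assms by simp
  also have "\<dots> = complex_of_real (norm u) * cis (Im (Ln u))"
    using assms by (subst Ln) (simp only: exp_add cis_conv_exp, simp add: exp_of_real)
  finally show "u = complex_of_real (norm u) * cis (Im (Ln u))" .
  have "u powr complex_of_real \<alpha> =
      exp (complex_of_real (\<alpha> * ln (norm u)) + \<i> * complex_of_real (\<alpha> * Im (Ln u)))"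
    using assms by (subst (1) powr_def, subst Ln) (simp add: algebra_simps)
  then show "u powr complex_of_real \<alpha> = complex_of_real (norm u powr \<alpha>) * cis (\<alpha> * Im (Ln u))"
    using assms by (simp only: exp_add cis_conv_exp exp_of_real) (simp add: powr_def)
qed

text \<open>
  Let \<open>\<phi>\<close> be the argument of \<open>u\<close>. If \<open>\<phi> \<noteq> 0\<close> and \<open>\<alpha> \<le> 1\<close>, the imaginary parts of \<open>r u\<close> and \<open>u powr \<alpha>\<close>
  have the same sign and cannot cancel. If \<open>\<alpha> > 1\<close>, rotate the equation by \<open>- \<phi>\<close>: then
  \<open>sin ((\<alpha> - 1) \<phi>)\<close> would have to have the sign of \<open>- sin \<phi>\<close>, which is impossible for \<open>\<alpha> - 1 \<le> 1\<close>.
\<close>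
lemma trinomial_root_positive:
  fixes r \<alpha> :: real and u :: complex
  assumes r: "r > 0" and \<alpha>: "0 < \<alpha>" "\<alpha> \<le> 2" and u: "u \<notin> \<real>\<^sub>\<le>\<^sub>0"
    and eq: "complex_of_real r * u + u powr complex_of_real \<alpha> = 1"
  shows "u = complex_of_real (norm u)" "r * norm u + norm u powr \<alpha> = 1"
proof -
  define R \<phi> where "R = norm u" and "\<phi> = Im (Ln u)"
  have nz: "u \<noteq> 0" using u by auto
  then have R: "R > 0" by (simp add: R_def)
  have \<phi>: "\<bar>\<phi>\<bar> < pi"
    using u mpi_less_Im_Ln[OF nz] Im_Ln_less_pi[OF u] by (simp add: \<phi>_def abs_less_iff)
  note polar = polar_powr[OF nz, folded R_def \<phi>_def]
  have eq': "complex_of_real (r * R) * cis \<phi> + complex_of_real (R powr \<alpha>) * cis (\<alpha> * \<phi>) = 1"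
    using eq unfolding polar(2) by (subst (asm) polar(1)) (simp add: mult.assoc)
  have "\<phi> = 0"
  proof (rule ccontr)
    assume "\<phi> \<noteq> 0"
    show False
    proof (cases "\<alpha> \<le> 1")
      case True
      have "r * R * sin \<phi> + R powr \<alpha> * sin (\<alpha> * \<phi>) = 0"
        using arg_cong[OF eq', of Im] by simp
      then have "r * R * (sin \<phi>)\<^sup>2 + R powr \<alpha> * (sin \<phi> * sin (\<alpha> * \<phi>)) = 0"
        by (simp add: power2_eq_square algebra_simps) (metis distrib_left mult.assoc mult.left_commute mult_zero_right)
      moreover have "0 < R powr \<alpha> * (sin \<phi> * sin (\<alpha> * \<phi>))"
        using sin_mult_same_sign[of \<phi> \<alpha>] \<phi> \<open>\<phi> \<noteq> 0\<close> True \<alpha> R by simp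
      moreover have "0 \<le> r * R * (sin \<phi>)\<^sup>2"
        using r R by simp
      ultimately show False by linarith
    next
      case False
      have "complex_of_real (r * R) * (cis \<phi> * cis (- \<phi>)) + complex_of_real (R powr \<alpha>) * (cis (\<alpha> * \<phi>) * cis (- \<phi>)) = cis (- \<phi>)"
        using arg_cong[OF eq', of "\<lambda>z. z * cis (- \<phi>)"] by (simp add: distrib_right mult.assoc del: cis_mult)
      then have "complex_of_real (r * R) + complex_of_real (R powr \<alpha>) * cis ((\<alpha> - 1) * \<phi>) = cis (- \<phi>)"
        by (simp add: cis_mult algebra_simps)
      from arg_cong[OF this, of Im] have "R powr \<alpha> * sin ((\<alpha> - 1) * \<phi>) = - sin \<phi>"
        by simp
      then have "R powr \<alpha> * (sin \<phi> * sin ((\<alpha> - 1) * \<phi>)) = - (sin \<phi>)\<^sup>2"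
        by (simp add: power2_eq_square mult.left_commute)
      moreover have "0 < R powr \<alpha> * (sin \<phi> * sin ((\<alpha> - 1) * \<phi>))"
        using sin_mult_same_sign[of \<phi> "\<alpha> - 1"] \<phi> \<open>\<phi> \<noteq> 0\<close> False \<alpha> R by simp
      ultimately show False
        by (smt (verit) zero_le_power2)
    qed
  qed
  then show "u = complex_of_real (norm u)"
    using polar(1) by (simp add: R_def)
  have "complex_of_real (r * R + R powr \<alpha>) = complex_of_real 1"
    using eq' \<open>\<phi> = 0\<close> by simp
  then show "r * norm u + norm u powr \<alpha> = 1"
    unfolding of_real_eq_iff R_def .
qed

lemma trinomial_root_unique:
  fixes r \<alpha> x y :: real
  assumes "r > 0" "\<alpha> > 0" "x > 0" "y > 0" "r * x + x powr \<alpha> = 1" "r * y + y powr \<alpha> = 1"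
  shows "x = y"
proof -
  have less: "\<not> a < b" if "a > 0" "r * a + a powr \<alpha> = r * b + b powr \<alpha>" for a b
  proof
    assume "a < b"
    then have "r * a < r * b" "a powr \<alpha> < b powr \<alpha>"
      using assms(1,2) that(1) by (auto intro: powr_less_mono2)
    then show False using that(2) by linarith
  qed
  show ?thesis
    using less[of x y] less[of y x] assms by (metis linorder_less_linear)
qed

text \<open>
  The common value of \<open>z G(z)\<close> at \<open>z = r exp (i \<pi> \<rho>)\<close> for all free stable laws of index \<open>\<alpha>\<close>,
  taken as a limit if the ray lies on the boundary of the upper half-plane.
\<close>
definition free_stable_profile :: "real \<Rightarrow> real \<Rightarrow> complex" where
  "free_stable_profile \<alpha> r = complex_of_real (r * (THE R. 0 < R \<and> r * R + R powr \<alpha> = 1))"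

lemma free_stable_profile_eq:
  assumes "r > 0" "0 < \<alpha>" "\<alpha> \<le> 2" "u \<notin> \<real>\<^sub>\<le>\<^sub>0"
    "complex_of_real r * u + u powr complex_of_real \<alpha> = 1"
  shows "complex_of_real r * u = free_stable_profile \<alpha> r"
proof -
  note root = trinomial_root_positive[OF assms]
  have "u \<noteq> 0" using assms(4) by auto
  then have "(THE R. 0 < R \<and> r * R + R powr \<alpha> = 1) = norm u"
    using root(2) trinomial_root_unique[OF assms(1,2)] by (intro the_equality) auto
  then show ?thesis
    unfolding free_stable_profile_def using root(1) by simp
qed

lemma (in real_distribution) cauchy_kernel_integrable:
  assumes "Im z > 0"
  shows "integrable M (\<lambda>x. 1 / (z - complex_of_real x))"
proof (rule integrable_const_bound)
  have "norm (1 / (z - complex_of_real x)) \<le> 1 / Im z" for x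
  proof -
    have "Im z \<le> norm (z - complex_of_real x)"
      using abs_Im_le_cmod[of "z - complex_of_real x"] assms by simp
    then show ?thesis
      using assms by (simp add: norm_divide frac_le)
  qed
  then show "AE x in M. norm (1 / (z - complex_of_real x)) \<le> 1 / Im z"
    by simp
qed measurable

lemma (in real_distribution) Im_cauchy_transform:
  assumes "Im z > 0"
  shows "Im (cauchy_transform M z) = - (LINT x|M. Im z / (norm (z - complex_of_real x))\<^sup>2)"
    and "integrable M (\<lambda>x. Im z / (norm (z - complex_of_real x))\<^sup>2)"
proof -
  have Im: "Im (1 / (z - complex_of_real x)) = - (Im z / (norm (z - complex_of_real x))\<^sup>2)" for x
    by (simp add: Im_divide cmod_power2)
  note int = cauchy_kernel_integrable[OF assms]
  show "integrable M (\<lambda>x. Im z / (norm (z - complex_of_real x))\<^sup>2)"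
    using integrable_Im[OF int] unfolding Im by simp
  show "Im (cauchy_transform M z) = - (LINT x|M. Im z / (norm (z - complex_of_real x))\<^sup>2)"
    unfolding cauchy_transform_def using integral_Im[OF int] unfolding Im by simp
qed

lemma (in real_distribution) Im_cauchy_transform_neg:
  assumes "Im z > 0"
  shows "Im (cauchy_transform M z) < 0"
proof -
  have "0 < (LINT x|M. Im z / (norm (z - complex_of_real x))\<^sup>2)"
  proof (rule expectation_greater)
    have "z \<noteq> complex_of_real x" for x
      using assms by auto
    then show "AE x in M. 0 < Im z / (norm (z - complex_of_real x))\<^sup>2"
      using assms by simp
  qed (rule Im_cauchy_transform(2)[OF assms])
  then show ?thesis
    using Im_cauchy_transform(1)[OF assms] by simp
qed

text \<open>
  Rotating \<open>w = G(z)\<close> by \<open>\<pi> \<rho>\<close> absorbs the phase of the Voiculescu transform. No branch of the power is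
  crossed: the argument of \<open>w\<close> lies in \<open>(- \<pi>, 0)\<close>, so that of \<open>u\<close> lies in \<open>(- \<pi>, \<pi>)\<close>.
\<close>
lemma free_stable_trinomial:
  assumes \<mu>: "free_stable_distribution \<alpha> \<rho> \<mu>" and \<rho>: "0 \<le> \<rho>" "\<rho> \<le> 1" and z: "Im z > 0"
  defines "u \<equiv> cis (pi * \<rho>) * cauchy_transform \<mu> z"
  shows "z * cis (- (pi * \<rho>)) * u + u powr complex_of_real \<alpha> = 1"
    and "u \<notin> \<real>\<^sub>\<le>\<^sub>0"
proof -
  interpret real_distribution \<mu>
    using \<mu> by (simp add: free_stable_distribution_def)
  define w where "w = cauchy_transform \<mu> z"
  have w: "Im w < 0"
    unfolding w_def by (rule Im_cauchy_transform_neg[OF z])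
  then have nz: "w \<noteq> 0" by auto
  have arg: "- pi < Im (Ln w)" "Im (Ln w) < 0"
    using mpi_less_Im_Ln[OF nz] Im_Ln_pos_le[OF nz] Im_Ln_le_pi[OF nz] w by linarith+
  have u: "u = exp (Ln w + \<i> * complex_of_real (pi * \<rho>))"
    unfolding u_def w_def[symmetric] by (simp only: exp_add exp_Ln[OF nz] cis_conv_exp mult.commute)
  have \<rho>': "0 \<le> pi * \<rho>" "pi * \<rho> \<le> pi"
    using \<rho> by (auto simp: mult_left_le)
  have Ln_u: "Ln u = Ln w + \<i> * complex_of_real (pi * \<rho>)"
  proof -
    have "- pi < Im (Ln w) + pi * \<rho>" "Im (Ln w) + pi * \<rho> \<le> pi"
      using arg \<rho>' by linarith+
    then show ?thesis
      unfolding u by (intro Ln_exp) simp_all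
  qed
  have u_nz: "u \<noteq> 0" by (simp add: u)
  show "u \<notin> \<real>\<^sub>\<le>\<^sub>0"
    using Im_Ln_eq_pi[OF u_nz] Ln_u arg \<rho>' u_nz
    by (auto simp: complex_nonpos_Reals_iff complex_eq_iff)
  have "1 / w - exp (complex_of_real (pi * \<alpha> * \<rho>) * \<i>) * w powr complex_of_real (\<alpha> - 1) = z"
    using \<mu> z free_stable_transform_inverse[OF w, of \<alpha> \<rho>]
    by (simp add: free_stable_distribution_def has_voiculescu_transform_def Let_def w_def)
  from arg_cong[OF this, of "\<lambda>z. z * w"]
  have "z * w = 1 - exp (complex_of_real (pi * \<alpha> * \<rho>) * \<i>) * (w powr complex_of_real (\<alpha> - 1) * w)"
    using nz by (simp add: left_diff_distrib mult.assoc)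
  also have "w powr complex_of_real (\<alpha> - 1) * w = w powr complex_of_real \<alpha>"
    using nz powr_add[of w "complex_of_real (\<alpha> - 1)" 1] by simp
  also have "exp (complex_of_real (pi * \<alpha> * \<rho>) * \<i>) * w powr complex_of_real \<alpha> = u powr complex_of_real \<alpha>"
    using nz u_nz by (simp add: powr_def Ln_u exp_add[symmetric] algebra_simps)
  finally have "z * w + u powr complex_of_real \<alpha> = 1" by simp
  moreover have "z * cis (- (pi * \<rho>)) * u = z * w"
    unfolding u_def w_def[symmetric]
    by (simp only: mult.assoc mult.left_commute[of "cis (- (pi * \<rho>))"]) 
       (simp add: mult.assoc[symmetric] cis_mult)
  ultimately show "z * cis (- (pi * \<rho>)) * u + u powr complex_of_real \<alpha> = 1"
    by (simp only:)
qed

text \<open>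
  On the ray at angle \<open>\<pi> \<rho>\<close> the coefficient of \<open>u\<close> in the trinomial equation is the positive number \<open>r\<close>.
\<close>
lemma free_stable_interior_average:
  assumes \<mu>: "free_stable_distribution \<alpha> \<rho> \<mu>" and \<alpha>: "0 < \<alpha>" "\<alpha> \<le> 2" and \<rho>: "0 < \<rho>" "\<rho> < 1" and r: "r > 0"
  shows "(LINT x|\<mu>. complex_of_real r / (complex_of_real r + - complex_of_real x * cis (- (pi * \<rho>))))
    = free_stable_profile \<alpha> r"
proof -
  interpret real_distribution \<mu>
    using \<mu> by (simp add: free_stable_distribution_def)
  define z where "z = complex_of_real r * cis (pi * \<rho>)"
  have "0 < sin (pi * \<rho>)"
    using \<rho> by (intro sin_gt_zero) auto
  then have z: "Im z > 0"
    using r by (simp add: z_def)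
  define u where "u = cis (pi * \<rho>) * cauchy_transform \<mu> z"
  have "z * cis (- (pi * \<rho>)) = complex_of_real r"
    by (simp add: z_def mult.assoc cis_mult)
  then have "complex_of_real r * u = free_stable_profile \<alpha> r"
    using free_stable_trinomial[OF \<mu> _ _ z] \<rho> r \<alpha>
    by (intro free_stable_profile_eq) (simp_all add: u_def)
  moreover have "complex_of_real r * u = (LINT x|\<mu>. z * (1 / (z - complex_of_real x)))"
    unfolding integral_mult_right_zero u_def cauchy_transform_def by (simp add: z_def)
  moreover have "z * (1 / (z - complex_of_real x)) =
      complex_of_real r / (complex_of_real r + - complex_of_real x * cis (- (pi * \<rho>)))" for x
  proof -
    have "z - complex_of_real x = cis (pi * \<rho>) * (complex_of_real r + - complex_of_real x * cis (- (pi * \<rho>)))"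
      by (simp add: z_def right_diff_distrib mult.left_commute cis_mult)
    then show ?thesis
      by (simp add: z_def)
  qed
  ultimately show ?thesis by simp
qed

section \<open>Reflection and the one-sided laws\<close>

text \<open>
  If \<open>X\<close> has Cauchy transform \<open>G\<close>, then \<open>- X\<close> has Cauchy transform \<open>z \<mapsto> - cnj (G (- cnj z))\<close>.
\<close>
lemma free_stable_reflect:
  assumes \<mu>: "free_stable_distribution \<alpha> \<rho> \<mu>"
  shows "free_stable_distribution \<alpha> (1 - \<rho>) (distr \<mu> borel uminus)"
proof -
  interpret real_distribution \<mu>
    using \<mu> by (simp add: free_stable_distribution_def)
  have voiculescu: "1 / w' + free_stable_transform \<alpha> (1 - \<rho>) (1 / w') = z"
    if z: "Im z > 0" and w': "w' = cauchy_transform (distr \<mu> borel uminus) z" for z w'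
  proof -
    define w where "w = cauchy_transform \<mu> (- cnj z)"
    have z': "Im (- cnj z) > 0"
      using z by simp
    have w: "Im w < 0"
      unfolding w_def by (rule Im_cauchy_transform_neg[OF z'])
    then have nz: "w \<noteq> 0" by auto
    have "w' = (LINT x|\<mu>. 1 / (z + complex_of_real x))"
      unfolding w' cauchy_transform_def by (subst integral_distr) auto
    also have "\<dots> = (LINT x|\<mu>. cnj (- (1 / (- cnj z - complex_of_real x))))"
    proof (rule Bochner_Integration.integral_cong[OF refl])
      fix x
      have "- (1 / (- cnj z - complex_of_real x)) = 1 / (cnj z + complex_of_real x)"
        by (metis (no_types, opaque_lifting) diff_conv_add_uminus divide_minus_right minus_add_distrib minus_minus)
      then show "1 / (z + complex_of_real x) = cnj (- (1 / (- cnj z - complex_of_real x)))"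
        by simp
    qed
    also have "\<dots> = - cnj w"
      unfolding Bochner_Integration.integral_cnj w_def cauchy_transform_def by simp
    finally have w'_eq: "w' = - cnj w" .
    have arg: "- pi < Im (Ln w)" "Im (Ln w) < 0"
      using mpi_less_Im_Ln[OF nz] Im_Ln_pos_le[OF nz] Im_Ln_le_pi[OF nz] w by linarith+
    have exp_w': "w' = exp (cnj (Ln w) - \<i> * complex_of_real pi)"
      using nz by (simp add: w'_eq exp_diff flip: exp_cnj)
    have Ln_w': "Ln w' = cnj (Ln w) - \<i> * complex_of_real pi"
      unfolding exp_w' by (rule Ln_exp) (use arg in auto)
    have "1 / w - exp (complex_of_real (pi * \<alpha> * \<rho>) * \<i>) * w powr complex_of_real (\<alpha> - 1) = - cnj z"
      using \<mu> z' free_stable_transform_inverse[OF w, of \<alpha> \<rho>]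
      by (simp add: free_stable_distribution_def has_voiculescu_transform_def Let_def w_def)
    from arg_cong[OF this, of "\<lambda>z. - cnj z"]
    have eq: "1 / w' + cnj (exp (complex_of_real (pi * \<alpha> * \<rho>) * \<i>) * w powr complex_of_real (\<alpha> - 1)) = z"
      by (simp add: w'_eq)
    have "cnj (exp (complex_of_real (pi * \<alpha> * \<rho>) * \<i>) * w powr complex_of_real (\<alpha> - 1)) =
        exp (- (complex_of_real (pi * \<alpha> * \<rho>) * \<i>) + complex_of_real (\<alpha> - 1) * cnj (Ln w))"
    proof -
      have "exp (complex_of_real (pi * \<alpha> * \<rho>) * \<i>) * w powr complex_of_real (\<alpha> - 1) =
          exp (complex_of_real (pi * \<alpha> * \<rho>) * \<i> + complex_of_real (\<alpha> - 1) * Ln w)"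
        using nz by (simp add: powr_def exp_add)
      then show ?thesis
        by (simp add: exp_cnj del: exp_of_real)
    qed
    also have "- (complex_of_real (pi * \<alpha> * \<rho>) * \<i>) + complex_of_real (\<alpha> - 1) * cnj (Ln w) =
        complex_of_real (pi * \<alpha> * (1 - \<rho>)) * \<i> + complex_of_real (\<alpha> - 1) * Ln w' - \<i> * complex_of_real pi"
      unfolding Ln_w' by (simp add: algebra_simps)
    also have "exp \<dots> = - (exp (complex_of_real (pi * \<alpha> * (1 - \<rho>)) * \<i>) * w' powr complex_of_real (\<alpha> - 1))"
      using nz by (simp add: powr_def exp_diff exp_add w'_eq)
    finally have "1 / w' - exp (complex_of_real (pi * \<alpha> * (1 - \<rho>)) * \<i>) * w' powr complex_of_real (\<alpha> - 1) = z"
      using eq by simp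
    moreover have "Im w' < 0"
      using w by (simp add: w'_eq)
    ultimately show ?thesis
      using free_stable_transform_inverse[of w' \<alpha> "1 - \<rho>"] by simp
  qed
  show ?thesis
    unfolding free_stable_distribution_def has_voiculescu_transform_def Let_def
    using voiculescu by (simp add: real_distribution_distr)
qed

lemma cis_minus_pi: "cis (- pi) = - 1"
  by (simp add: complex_eq_iff)

text \<open>
  For \<open>\<rho> = 1\<close> the ray at angle \<open>\<pi> \<rho>\<close> is the negative half-line, on the boundary of the domain of \<open>G\<close>.
  At \<open>z = - r + i \<epsilon>\<close> the imaginary part of the trinomial equation forces
  \<open>r \<bar>Im G(z)\<bar> \<le> \<epsilon> \<bar>G(z)\<bar>\<close>, and \<open>\<bar>G(z)\<bar>\<close> is bounded because \<open>\<alpha> < 1\<close>. As \<open>\<bar>Im G(z)\<bar>\<close> is at least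
  \<open>1 / (2 \<epsilon>)\<close> times the mass within \<open>\<epsilon>\<close> of \<open>- r\<close>, this mass is \<open>O(\<epsilon>\<^sup>2)\<close>.
\<close>
lemma one_sided_local_mass:
  assumes \<mu>: "free_stable_distribution \<alpha> 1 \<mu>" and \<alpha>: "0 < \<alpha>" "\<alpha> < 1" and r0: "r0 > 0"
  obtains C where "\<And>r \<epsilon>. r0 \<le> r \<Longrightarrow> 0 < \<epsilon> \<Longrightarrow> measure \<mu> {x. \<bar>x + r\<bar> \<le> \<epsilon>} \<le> C * \<epsilon>\<^sup>2"
proof -
  interpret real_distribution \<mu>
    using \<mu> by (simp add: free_stable_distribution_def)
  \<comment> \<open>if \<open>\<bar>u\<bar> > 1\<close>, the equation gives \<open>r0 \<bar>u\<bar> \<le> 2 \<bar>u\<bar> powr \<alpha>\<close>\<close>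
  define K where "K = max 1 ((2 / r0) powr (1 / (1 - \<alpha>)))"
  have "measure \<mu> {x. \<bar>x + r\<bar> \<le> \<epsilon>} \<le> 2 * K / r0 * \<epsilon>\<^sup>2" if r: "r0 \<le> r" and \<epsilon>: "0 < \<epsilon>" for r \<epsilon>
  proof -
    define z where "z = Complex (- r) \<epsilon>"
    have z: "Im z > 0" using \<epsilon> by (simp add: z_def)
    define u where "u = - cauchy_transform \<mu> z"
    have eq: "- z * u + u powr complex_of_real \<alpha> = 1"
      using free_stable_trinomial(1)[OF \<mu> _ _ z] cis_minus_pi by (simp add: u_def)
    have Im_u: "Im u > 0"
      using Im_cauchy_transform_neg[OF z] by (simp add: u_def)
    then have nz: "u \<noteq> 0" by auto
    have norm_u: "norm u \<le> K"
    proof (cases "norm u \<le> 1")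
      case False
      have "r0 \<le> norm z"
        using abs_Re_le_cmod[of z] r r0 by (simp add: z_def)
      then have "r0 * norm u \<le> norm (z * u)"
        by (simp add: norm_mult mult_right_mono)
      also have "z * u = u powr complex_of_real \<alpha> - 1"
        using eq by (simp add: algebra_simps)
      also have "norm \<dots> \<le> norm u powr \<alpha> + 1"
        using norm_triangle_ineq4[of "u powr complex_of_real \<alpha>" 1] by (simp add: norm_powr_real_powr')
      also have "\<dots> \<le> 2 * norm u powr \<alpha>"
        using False \<alpha> by (simp add: ge_one_powr_ge_zero)
      finally have "norm u / norm u powr \<alpha> \<le> 2 / r0"
        using r0 nz by (simp add: field_simps)
      then have "norm u powr (1 - \<alpha>) \<le> 2 / r0"
        using nz by (simp add: powr_diff)
      then have "(norm u powr (1 - \<alpha>)) powr (1 / (1 - \<alpha>)) \<le> (2 / r0) powr (1 / (1 - \<alpha>))"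
        using \<alpha> by (intro powr_mono2) auto
      then show ?thesis
        using nz \<alpha> by (simp add: powr_powr K_def)
    qed (simp add: K_def)
    have "0 < Im (u powr complex_of_real \<alpha>)"
    proof -
      have "0 < Im (Ln u)" "Im (Ln u) < pi"
        using Im_Ln_pos_lt_imp[OF Im_u] by auto
      then have "0 < sin (\<alpha> * Im (Ln u))"
        using \<alpha> by (intro sin_gt_zero) (auto intro: le_less_trans[OF mult_left_le_one_le])
      then show ?thesis
        using nz by (subst polar_powr(2)[OF nz]) simp
    qed
    then have "r * Im u - \<epsilon> * Re u < 0"
      using arg_cong[OF eq, of Im] by (simp add: z_def)
    moreover have "Re u \<le> K"
      using norm_u complex_Re_le_cmod[of u] by linarith
    then have "\<epsilon> * Re u \<le> \<epsilon> * K"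
      using \<epsilon> by simp
    moreover have "r0 * Im u \<le> r * Im u"
      using r Im_u by simp
    ultimately have "Im u \<le> \<epsilon> * K / r0"
      using r0 by (simp add: field_simps)
    moreover have "measure \<mu> {x. \<bar>x + r\<bar> \<le> \<epsilon>} * (1 / (2 * \<epsilon>)) \<le> Im u"
    proof -
      have "measure \<mu> {x. \<bar>x + r\<bar> \<le> \<epsilon>} * (1 / (2 * \<epsilon>)) = (LINT x|\<mu>. indicator {x. \<bar>x + r\<bar> \<le> \<epsilon>} x * (1 / (2 * \<epsilon>)))"
        by simp
      also have "\<dots> \<le> (LINT x|\<mu>. Im z / (norm (z - complex_of_real x))\<^sup>2)"
      proof (rule integral_mono)
        show "integrable \<mu> (\<lambda>x. indicator {x. \<bar>x + r\<bar> \<le> \<epsilon>} x * (1 / (2 * \<epsilon>)))"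
          by (intro integrable_mult_left integrable_real_indicator) (auto simp: less_top[symmetric])
        fix x :: real
        have norm_zx: "(norm (z - complex_of_real x))\<^sup>2 = (x + r)\<^sup>2 + \<epsilon>\<^sup>2"
          unfolding cmod_power2 z_def by (simp add: power2_eq_square algebra_simps)
        show "indicator {x. \<bar>x + r\<bar> \<le> \<epsilon>} x * (1 / (2 * \<epsilon>)) \<le> Im z / (norm (z - complex_of_real x))\<^sup>2"
        proof (cases "\<bar>x + r\<bar> \<le> \<epsilon>")
          case True
          then have "(x + r)\<^sup>2 \<le> \<epsilon>\<^sup>2"
            using \<epsilon> abs_le_square_iff[of "x + r" \<epsilon>] by simp
          moreover have "0 < (x + r)\<^sup>2 + \<epsilon>\<^sup>2"
            using \<epsilon> by (simp add: add_nonneg_pos)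
          ultimately have "\<epsilon> / (2 * \<epsilon>\<^sup>2) \<le> \<epsilon> / ((x + r)\<^sup>2 + \<epsilon>\<^sup>2)"
            using \<epsilon> by (intro divide_left_mono) auto
          then show ?thesis
            unfolding norm_zx using True \<epsilon> by (simp add: z_def power2_eq_square)
        qed (use \<epsilon> in \<open>unfold norm_zx, simp add: z_def\<close>)
      qed (rule Im_cauchy_transform(2)[OF z])
      also have "\<dots> = Im u"
        using Im_cauchy_transform(1)[OF z] by (simp add: u_def)
      finally show ?thesis .
    qed
    ultimately have "measure \<mu> {x. \<bar>x + r\<bar> \<le> \<epsilon>} * (1 / (2 * \<epsilon>)) \<le> \<epsilon> * K / r0"
      by linarith
    then show ?thesis
      using \<epsilon> r0 by (simp add: field_simps power2_eq_square)
  qed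
  then show ?thesis
    using that by blast
qed

text \<open>
  An interval of length \<open>1\<close> on the negative half-line is covered by \<open>n + 1\<close> intervals of radius
  \<open>1 / n\<close>, each of mass \<open>O(1 / n\<^sup>2)\<close>.
\<close>
lemma one_sided_AE_nonneg:
  assumes \<mu>: "free_stable_distribution \<alpha> 1 \<mu>" and \<alpha>: "0 < \<alpha>" "\<alpha> < 1"
  shows "AE x in \<mu>. 0 \<le> x"
proof -
  interpret real_distribution \<mu>
    using \<mu> by (simp add: free_stable_distribution_def)
  have null: "AE x in \<mu>. x \<notin> {- (q + 1)..- q}" if q: "q > 0" for q :: real
  proof -
    obtain C where C: "\<And>r \<epsilon>. q \<le> r \<Longrightarrow> 0 < \<epsilon> \<Longrightarrow> measure \<mu> {x. \<bar>x + r\<bar> \<le> \<epsilon>} \<le> C * \<epsilon>\<^sup>2"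
      using one_sided_local_mass[OF \<mu> \<alpha> q] by blast
    have bound: "measure \<mu> {- (q + 1)..- q} \<le> (real n + 1) * (C * (1 / real n)\<^sup>2)" if n: "n \<ge> 1" for n :: nat
    proof -
      define J where "J = (\<lambda>k::nat. {x::real. \<bar>x + (q + real k / real n)\<bar> \<le> 1 / real n})"
      have "{- (q + 1)..- q} \<subseteq> (\<Union>k\<in>{..n}. J k)"
      proof
        fix x assume x: "x \<in> {- (q + 1)..- q}"
        define y where "y = (- x - q) * real n"
        have y: "0 \<le> y" "y \<le> real n"
          using x n by (auto simp: y_def mult_left_le_one_le)
        have k: "real (nat \<lfloor>y\<rfloor>) \<le> y" "y < real (nat \<lfloor>y\<rfloor>) + 1"
          using y(1) by linarith+
        have "x + (q + real (nat \<lfloor>y\<rfloor>) / real n) = (real (nat \<lfloor>y\<rfloor>) - y) / real n"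
          using n by (simp add: y_def field_simps)
        also have "\<bar>\<dots>\<bar> \<le> 1 / real n"
        proof -
          have "\<bar>real (nat \<lfloor>y\<rfloor>) - y\<bar> \<le> 1"
            using k by linarith
          then show ?thesis
            using n by (simp only: abs_divide abs_of_nat divide_right_mono of_nat_0_le_iff)
        qed
        finally have "x \<in> J (nat \<lfloor>y\<rfloor>)"
          by (simp add: J_def)
        moreover have "nat \<lfloor>y\<rfloor> \<le> n"
          using k(1) y(2) by linarith
        ultimately show "x \<in> (\<Union>k\<in>{..n}. J k)"
          by blast
      qed
      then have "measure \<mu> {- (q + 1)..- q} \<le> measure \<mu> (\<Union>k\<in>{..n}. J k)"
        by (intro finite_measure_mono) (auto simp: J_def)
      also have "\<dots> \<le> (\<Sum>k\<in>{..n}. measure \<mu> (J k))"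
        by (intro finite_measure_subadditive_finite) (auto simp: J_def)
      also have "\<dots> \<le> (\<Sum>k\<in>{..n}. C * (1 / real n)\<^sup>2)"
        unfolding J_def using n by (intro sum_mono C) auto
      also have "\<dots> = (real n + 1) * (C * (1 / real n)\<^sup>2)"
        by (simp add: add.commute)
      finally show ?thesis .
    qed
    have "(\<lambda>n::nat. (real n + 1) * (C * (1 / real n)\<^sup>2)) \<longlonglongrightarrow> 0"
      by real_asymp
    then have "measure \<mu> {- (q + 1)..- q} \<le> 0"
      by (rule tendsto_lowerbound) (use bound in \<open>auto intro: eventually_sequentiallyI[of 1]\<close>)
    then have "measure \<mu> {- (q + 1)..- q} = 0"
      by (simp add: measure_le_0_iff)
    then show ?thesis
      by (subst prob_eq_0[symmetric]) auto
  qed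
  have "AE x in \<mu>. \<forall>q::rat. q > 0 \<longrightarrow> x \<notin> {- (of_rat q + 1)..- of_rat q}"
    unfolding AE_all_countable using null by (auto simp: zero_less_of_rat_iff)
  then show ?thesis
  proof eventually_elim
    case (elim x)
    show ?case
    proof (rule ccontr)
      assume "\<not> 0 \<le> x"
      then have "max 0 (- x - 1) < - x" by simp
      then obtain q where q: "max 0 (- x - 1) < of_rat q" "of_rat q < - x"
        using of_rat_dense by blast
      then have "q > 0" by simp
      with elim q show False by auto
    qed
  qed
qed

text \<open>
  Once the law is known to live on \<open>x \<ge> 0\<close>, its Cauchy transform extends continuously to the negative
  half-line, and the trinomial equation passes to the limit.
\<close>
lemma one_sided_boundary_average:
  assumes \<mu>: "free_stable_distribution \<alpha> 1 \<mu>" and \<alpha>: "0 < \<alpha>" "\<alpha> < 1" and r: "r > 0"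
  shows "(LINT x|\<mu>. complex_of_real r / (complex_of_real r + complex_of_real x)) = free_stable_profile \<alpha> r"
proof -
  interpret real_distribution \<mu>
    using \<mu> by (simp add: free_stable_distribution_def)
  define z where "z = (\<lambda>n. Complex (- r) (inverse (real (Suc n))))"
  define u where "u = (\<lambda>n. - cauchy_transform \<mu> (z n))"
  define V where "V = (LINT x|\<mu>. 1 / (r + x))"
  have z_pos: "Im (z n) > 0" for n
    by (simp add: z_def)
  have z_lim: "z \<longlonglongrightarrow> - complex_of_real r"
    unfolding tendsto_complex_iff z_def using LIMSEQ_inverse_real_of_nat by simp
  have V_integrable: "integrable \<mu> (\<lambda>x. 1 / (r + x))"
  proof (rule integrable_const_bound)
    show "AE x in \<mu>. norm (1 / (r + x)) \<le> 1 / r"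
      using one_sided_AE_nonneg[OF \<mu> \<alpha>] by eventually_elim (use r in \<open>auto simp: field_simps\<close>)
  qed simp
  have V_pos: "V > 0"
    unfolding V_def
  proof (rule expectation_greater[OF V_integrable])
    show "AE x in \<mu>. 0 < 1 / (r + x)"
      using one_sided_AE_nonneg[OF \<mu> \<alpha>] by eventually_elim (use r in auto)
  qed
  have V_complex: "(LINT x|\<mu>. 1 / (complex_of_real r + complex_of_real x)) = complex_of_real V"
    unfolding V_def integral_complex_of_real[symmetric] by simp
  have "(\<lambda>n. LINT x|\<mu>. 1 / (z n - complex_of_real x)) \<longlonglongrightarrow>
      (LINT x|\<mu>. - (1 / (complex_of_real r + complex_of_real x)))"
  proof (rule integral_dominated_convergence)
    show "integrable \<mu> (\<lambda>x. 1 / r)" by simp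
    show "AE x in \<mu>. (\<lambda>n. 1 / (z n - complex_of_real x)) \<longlonglongrightarrow>
        - (1 / (complex_of_real r + complex_of_real x))"
      using one_sided_AE_nonneg[OF \<mu> \<alpha>]
    proof eventually_elim
      case (elim x)
      have "complex_of_real (- (r + x)) \<noteq> 0"
        unfolding of_real_eq_0_iff using r elim by linarith
      then have "- complex_of_real r - complex_of_real x \<noteq> 0"
        by simp
      then have "(\<lambda>n. 1 / (z n - complex_of_real x)) \<longlonglongrightarrow> 1 / (- complex_of_real r - complex_of_real x)"
        by (intro tendsto_intros z_lim)
      also have "- complex_of_real r - complex_of_real x = - (complex_of_real r + complex_of_real x)"
        by simp
      finally show ?case
        by (simp only: divide_minus_right)
    qed
    show "AE x in \<mu>. norm (1 / (z n - complex_of_real x)) \<le> 1 / r" for n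
      using one_sided_AE_nonneg[OF \<mu> \<alpha>]
    proof eventually_elim
      case (elim x)
      have "r \<le> norm (z n - complex_of_real x)"
        using abs_Re_le_cmod[of "z n - complex_of_real x"] elim r by (simp add: z_def)
      then show ?case
        using r by (simp add: norm_divide frac_le)
    qed
  qed measurable
  then have "(\<lambda>n. cauchy_transform \<mu> (z n)) \<longlonglongrightarrow> - complex_of_real V"
    unfolding cauchy_transform_def using V_complex by simp
  then have u_lim: "u \<longlonglongrightarrow> complex_of_real V"
    unfolding u_def using tendsto_minus by fastforce
  have V_slit: "complex_of_real V \<notin> \<real>\<^sub>\<le>\<^sub>0"
    using V_pos by (simp add: complex_nonpos_Reals_iff)
  have "(\<lambda>n. - z n * u n + u n powr complex_of_real \<alpha>) \<longlonglongrightarrow>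
      - (- complex_of_real r) * complex_of_real V + complex_of_real V powr complex_of_real \<alpha>"
    using V_slit by (intro tendsto_intros z_lim u_lim) auto
  moreover have "- z n * u n + u n powr complex_of_real \<alpha> = 1" for n
    using free_stable_trinomial(1)[OF \<mu> _ _ z_pos[of n]] cis_minus_pi by (simp add: u_def)
  ultimately have "complex_of_real r * complex_of_real V + complex_of_real V powr complex_of_real \<alpha> = 1"
    using LIMSEQ_unique[OF _ tendsto_const] by simp
  then have "complex_of_real r * complex_of_real V = free_stable_profile \<alpha> r"
    using V_slit r \<alpha> by (intro free_stable_profile_eq) auto
  moreover have "(LINT x|\<mu>. complex_of_real r / (complex_of_real r + complex_of_real x)) =
     complex_of_real r * complex_of_real V"
    unfolding V_complex[symmetric] integral_mult_right_zero[symmetric] by simp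
  ultimately show ?thesis by simp
qed

section \<open>Mellin transforms of free stable laws\<close>

lemma admissibleD:
  assumes "(\<alpha>, \<rho>) \<in> admissible"
  shows "0 < \<alpha>" "\<alpha> \<le> 2" "0 \<le> \<rho>" "\<rho> \<le> 1" "\<rho> = 0 \<or> \<rho> = 1 \<Longrightarrow> \<alpha> < 1"
proof -
  have "0 < 1 - inverse \<alpha>" "inverse \<alpha> < 1" if "\<alpha> > 1"
    using that by (simp_all add: field_simps)
  then show "0 < \<alpha>" "\<alpha> \<le> 2" "0 \<le> \<rho>" "\<rho> \<le> 1" "\<rho> = 0 \<or> \<rho> = 1 \<Longrightarrow> \<alpha> < 1"
    using assms by (force simp: admissible_def)+
qed

text \<open>
  The line through \<open>0\<close> in direction \<open>cis \<theta>\<close> meets the real axis only at \<open>0\<close>. By homogeneity the bound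
  follows from the two unit points \<open>cis \<theta>\<close> and \<open>- cis \<theta>\<close>.
\<close>
lemma line_sector_bound:
  assumes "sin \<theta> \<noteq> 0"
  obtains c where "c > 0"
    "\<And>r x. r > 0 \<Longrightarrow> c * (r + \<bar>x\<bar>) \<le> norm (complex_of_real r - complex_of_real x * cis \<theta>)"
proof -
  have slit: "cis \<theta> \<notin> \<real>\<^sub>\<le>\<^sub>0" "- cis \<theta> \<notin> \<real>\<^sub>\<le>\<^sub>0"
    using assms by (auto simp: complex_nonpos_Reals_iff)
  obtain c1 where c1_pos: "c1 > 0"
    and c1: "\<And>r. r \<ge> 0 \<Longrightarrow> c1 * (r + 1) \<le> norm (complex_of_real r + cis \<theta>)"
    using norm_add_lower_bound[OF slit(1)] by blast
  obtain c2 where c2_pos: "c2 > 0"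
    and c2: "\<And>r. r \<ge> 0 \<Longrightarrow> c2 * (r + 1) \<le> norm (complex_of_real r + - cis \<theta>)"
    using norm_add_lower_bound[OF slit(2)] by blast
  define c where "c = min 1 (min c1 c2)"
  have scale: "c * (r + y) \<le> norm (complex_of_real r + complex_of_real y * b)"
    if b: "\<And>r. r \<ge> 0 \<Longrightarrow> c * (r + 1) \<le> norm (complex_of_real r + b)" and "r > 0" "y > 0" for r y b
  proof -
    have "y * (c * (r / y + 1)) \<le> y * norm (complex_of_real (r / y) + b)"
      using that by (intro mult_left_mono b) auto
    also have "y * norm (complex_of_real (r / y) + b) = norm (complex_of_real y * (complex_of_real (r / y) + b))"
      using that by (simp add: norm_mult)
    also have "complex_of_real y * (complex_of_real (r / y) + b) = complex_of_real r + complex_of_real y * b"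
      using that by (simp add: distrib_left)
    also have "y * (c * (r / y + 1)) = c * (r + y)"
      using that by (simp add: field_simps)
    finally show ?thesis .
  qed
  have "c * (r + \<bar>x\<bar>) \<le> norm (complex_of_real r - complex_of_real x * cis \<theta>)" if "r > 0" for r x
  proof -
    have le: "c * (r + 1) \<le> c1 * (r + 1)" "c * (r + 1) \<le> c2 * (r + 1)" if "r \<ge> 0" for r
      using that by (auto simp: c_def intro!: mult_right_mono)
    consider "x = 0" | "x > 0" | "x < 0" by linarith
    then show ?thesis
    proof cases
      case 1
      have "c * r \<le> 1 * r"
        using \<open>r > 0\<close> by (intro mult_right_mono) (auto simp: c_def)
      then show ?thesis
        using 1 \<open>r > 0\<close> by simp
    next
      case 2
      then show ?thesis
        using scale[OF order_trans[OF le(2) c2] \<open>r > 0\<close>, of x] by simp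
    next
      case 3
      then show ?thesis
        using scale[OF order_trans[OF le(1) c1] \<open>r > 0\<close>, of "- x"] by simp
    qed
  qed
  then show ?thesis
    using that[of c] c1_pos c2_pos by (simp add: c_def)
qed

text \<open>
  For \<open>\<rho> < 1\<close> all values of \<open>a\<close> lie on a line that meets the real axis only at \<open>0\<close>; for \<open>\<rho> = 1\<close> they are
  real and almost surely nonnegative.
\<close>
lemma free_stable_bounded_average:
  assumes \<mu>: "free_stable_distribution \<alpha> \<rho> \<mu>" and adm: "(\<alpha>, \<rho>) \<in> admissible" and \<rho>: "\<rho> > 0"
  obtains c where "bounded_stieltjes_average \<mu> (\<lambda>x. - (complex_of_real x * cis (- (pi * \<rho>)))) c"
    and "bounded_stieltjes_average \<mu> (\<lambda>x. cnj (- (complex_of_real x * cis (- (pi * \<rho>))))) c"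
proof -
  interpret real_distribution \<mu>
    using \<mu> by (simp add: free_stable_distribution_def)
  obtain c where c: "c > 0" "AE x in \<mu>. \<forall>r>0. c * (r + \<bar>x\<bar>) \<le> norm (complex_of_real r - complex_of_real x * cis (- (pi * \<rho>)))"
  proof (cases "\<rho> = 1")
    case True
    have "AE x in \<mu>. \<forall>r>0. 1 * (r + \<bar>x\<bar>) \<le> norm (complex_of_real r - complex_of_real x * cis (- (pi * \<rho>)))"
      using one_sided_AE_nonneg[OF \<mu>[unfolded True] admissibleD(1)[OF adm] admissibleD(5)[OF adm disjI2[OF True]]]
    proof eventually_elim
      case (elim x)
      have "norm (complex_of_real r + complex_of_real x) = r + x" if "r > 0" for r
        using that elim by (simp flip: of_real_add)
      then show ?case
        using elim True by (simp add: cis_minus_pi)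
    qed
    then show ?thesis
      using that[of 1] by simp
  next
    case False
    then have "0 < sin (pi * \<rho>)"
      using \<rho> admissibleD(4)[OF adm] by (intro sin_gt_zero) auto
    then have "sin (- (pi * \<rho>)) \<noteq> 0"
      by simp
    then obtain c where "c > 0"
      "\<And>r x. r > 0 \<Longrightarrow> c * (r + \<bar>x\<bar>) \<le> norm (complex_of_real r - complex_of_real x * cis (- (pi * \<rho>)))"
      using line_sector_bound by blast
    then show ?thesis
      by (intro that[of c]) auto
  qed
  have cnj_norm: "norm (complex_of_real r + cnj w) = norm (complex_of_real r + w)" for r w
    by (metis complex_cnj_add complex_cnj_complex_of_real complex_mod_cnj)
  show ?thesis
  proof (rule that)
    show "bounded_stieltjes_average \<mu> (\<lambda>x. - (complex_of_real x * cis (- (pi * \<rho>)))) c"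
    proof
      show "AE x in \<mu>. \<forall>r>0. c * (r + norm (- (complex_of_real x * cis (- (pi * \<rho>))))) \<le>
          norm (complex_of_real r + - (complex_of_real x * cis (- (pi * \<rho>))))"
        using c(2) by (simp add: norm_mult)
    qed (use c in auto)
    show "bounded_stieltjes_average \<mu> (\<lambda>x. cnj (- (complex_of_real x * cis (- (pi * \<rho>))))) c"
    proof
      show "AE x in \<mu>. \<forall>r>0. c * (r + norm (cnj (- (complex_of_real x * cis (- (pi * \<rho>)))))) \<le>
          norm (complex_of_real r + cnj (- (complex_of_real x * cis (- (pi * \<rho>)))))"
        unfolding cnj_norm complex_mod_cnj using c(2) by (simp add: norm_mult)
      show "(\<lambda>x. cnj (- (complex_of_real x * cis (- (pi * \<rho>))))) \<in> borel_measurable \<mu>"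
        by (simp add: cis_cnj)
    qed (use c in auto)
  qed
qed

text \<open>
  The profile is real, so replacing \<open>a\<close> by its conjugate does not change the average. The conjugate
  equation carries independent information after the Mellin transform is taken.
\<close>
lemma free_stable_average:
  assumes \<mu>: "free_stable_distribution \<alpha> \<rho> \<mu>" and adm: "(\<alpha>, \<rho>) \<in> admissible" and \<rho>: "\<rho> > 0" and r: "r > 0"
  shows "(LINT x|\<mu>. complex_of_real r / (complex_of_real r + - (complex_of_real x * cis (- (pi * \<rho>)))))
      = free_stable_profile \<alpha> r" (is ?direct)
    and "(LINT x|\<mu>. complex_of_real r / (complex_of_real r + cnj (- (complex_of_real x * cis (- (pi * \<rho>))))))
      = free_stable_profile \<alpha> r" (is ?conj)
proof -
  show direct: ?direct
  proof (cases "\<rho> = 1")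
    case True
    then show ?thesis
      using one_sided_boundary_average[OF \<mu>[unfolded True] admissibleD(1)[OF adm] admissibleD(5)[OF adm disjI2[OF True]] r]
      by (simp add: cis_minus_pi)
  next
    case False
    then show ?thesis
      using free_stable_interior_average[OF \<mu> admissibleD(1,2)[OF adm] \<rho> _ r] admissibleD(4)[OF adm]
      by simp
  qed
  have "(LINT x|\<mu>. complex_of_real r / (complex_of_real r + cnj (- (complex_of_real x * cis (- (pi * \<rho>))))))
     = (LINT x|\<mu>. cnj (complex_of_real r / (complex_of_real r + - (complex_of_real x * cis (- (pi * \<rho>))))))"
    by (simp only: complex_cnj_divide complex_cnj_add complex_cnj_complex_of_real)
  also have "\<dots> = cnj (free_stable_profile \<alpha> r)"
    unfolding Bochner_Integration.integral_cnj direct ..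
  also have "\<dots> = free_stable_profile \<alpha> r"
    by (simp add: free_stable_profile_def)
  finally show ?conj .
qed

lemma power_on_ray:
  assumes "x > 0" "- pi < \<theta>" "\<theta> \<le> pi"
  shows "exp (\<i> * complex_of_real t * Ln (complex_of_real x * cis \<theta>)) =
    complex_of_real (exp (- (t * \<theta>))) * cis (t * ln x)"
proof -
  have "complex_of_real x * cis \<theta> = exp (complex_of_real (ln x) + \<i> * complex_of_real \<theta>)"
    using assms(1) by (simp only: exp_add exp_of_real exp_ln cis_conv_exp)
  then have "Ln (complex_of_real x * cis \<theta>) = complex_of_real (ln x) + \<i> * complex_of_real \<theta>"
    using assms by simp
  then have "\<i> * complex_of_real t * Ln (complex_of_real x * cis \<theta>) =
      complex_of_real (- (t * \<theta>)) + \<i> * complex_of_real (t * ln x)"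
    by (simp add: algebra_simps)
  then show ?thesis
    by (simp only: exp_add exp_of_real cis_conv_exp)
qed

lemma (in real_distribution) signed_mellin_combination:
  "(LINT x|M. complex_of_real A * (if sgn x = 1 then cis (t * ln \<bar>x\<bar>) else 0) +
      complex_of_real B * (if sgn x = - 1 then cis (t * ln \<bar>x\<bar>) else 0))
    = complex_of_real A * signed_mellin 1 M t + complex_of_real B * signed_mellin (- 1) M t"
proof -
  have "integrable M (\<lambda>x. if sgn x = s then cis (t * ln \<bar>x\<bar>) else 0)" for s :: real
    by (rule integrable_const_bound[where B = 1]) auto
  then show ?thesis
    unfolding signed_mellin_def by (subst Bochner_Integration.integral_add) auto
qed

text \<open>
  The number \<open>a = - x cis (- \<pi> \<rho>)\<close> has argument \<open>\<pi> (1 - \<rho>)\<close> for \<open>x > 0\<close> and \<open>- \<pi> \<rho>\<close> for \<open>x < 0\<close>, so its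
  power moment is a combination of the two signed Mellin transforms. The conjugate of \<open>a\<close> reverses both
  arguments and gives a second linear equation with the same left side.
\<close>
lemma slope_mellin_free_stable:
  fixes t :: real
  assumes \<mu>: "free_stable_distribution \<alpha> \<rho> \<mu>" and adm: "(\<alpha>, \<rho>) \<in> admissible" and \<rho>: "\<rho> > 0"
  defines "S \<equiv> slope_mellin (free_stable_profile \<alpha>) t"
    and "B \<equiv> power_kernel_integral t 1"
  shows "S = B * (complex_of_real (exp (- (t * (pi * (1 - \<rho>))))) * signed_mellin 1 \<mu> t +
        complex_of_real (exp (t * (pi * \<rho>))) * signed_mellin (- 1) \<mu> t)"
    and "S = B * (complex_of_real (exp (t * (pi * (1 - \<rho>)))) * signed_mellin 1 \<mu> t +
        complex_of_real (exp (- (t * (pi * \<rho>)))) * signed_mellin (- 1) \<mu> t)"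
proof -
  interpret real_distribution \<mu>
    using \<mu> by (simp add: free_stable_distribution_def)
  obtain c where direct: "bounded_stieltjes_average \<mu> (\<lambda>x. - (complex_of_real x * cis (- (pi * \<rho>)))) c"
    and conj: "bounded_stieltjes_average \<mu> (\<lambda>x. cnj (- (complex_of_real x * cis (- (pi * \<rho>))))) c"
    using free_stable_bounded_average[OF \<mu> adm \<rho>] by blast
  have \<rho>1: "\<rho> \<le> 1" and bounds: "0 < pi * \<rho>" "pi * \<rho> \<le> pi"
    using admissibleD(4)[OF adm] \<rho> by (auto simp: mult_left_le)
  \<comment> \<open>for \<open>\<rho> = 1\<close> the angle \<open>- \<pi> \<rho>\<close> is outside the principal range, but then \<open>x < 0\<close> has probability \<open>0\<close>\<close>
  have support: "AE x in \<mu>. x < 0 \<longrightarrow> pi * \<rho> < pi"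
  proof (cases "\<rho> = 1")
    case True
    show ?thesis
      using one_sided_AE_nonneg[OF \<mu>[unfolded True] admissibleD(1)[OF adm] admissibleD(5)[OF adm disjI2[OF True]]] True by auto
  qed (use \<rho>1 in auto)
  have pos: "- (complex_of_real x * cis (- (pi * \<rho>))) = complex_of_real x * cis (pi * (1 - \<rho>))" for x
    by (simp add: complex_eq_iff right_diff_distrib cos_diff sin_diff)
  have cnj_pos: "cnj (- (complex_of_real x * cis (- (pi * \<rho>)))) = complex_of_real x * cis (- (pi * (1 - \<rho>)))" for x
    unfolding pos by (simp add: cis_cnj)
  have neg: "- (complex_of_real x * cis (- (pi * \<rho>))) = complex_of_real (- x) * cis (- (pi * \<rho>))" for x
    by simp
  have cnj_neg: "cnj (- (complex_of_real x * cis (- (pi * \<rho>)))) = complex_of_real (- x) * cis (pi * \<rho>)" for x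
    by (simp add: cis_cnj)
  have angle: "- pi < pi * (1 - \<rho>)" "pi * (1 - \<rho>) \<le> pi" "- pi < - (pi * (1 - \<rho>))" "- (pi * (1 - \<rho>)) \<le> pi"
    using bounds pi_gt_zero unfolding right_diff_distrib mult_1_right by linarith+
  have "S = B * (LINT x|\<mu>. (if - (complex_of_real x * cis (- (pi * \<rho>))) = 0 then 0
      else exp (\<i> * complex_of_real t * Ln (- (complex_of_real x * cis (- (pi * \<rho>)))))))"
    unfolding S_def B_def
    by (rule bounded_stieltjes_average.slope_mellin_average[OF direct])
       (rule free_stable_average(1)[OF \<mu> adm \<rho>])
  also have "(LINT x|\<mu>. (if - (complex_of_real x * cis (- (pi * \<rho>))) = 0 then 0
      else exp (\<i> * complex_of_real t * Ln (- (complex_of_real x * cis (- (pi * \<rho>))))))) =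
    (LINT x|\<mu>. complex_of_real (exp (- (t * (pi * (1 - \<rho>))))) * (if sgn x = 1 then cis (t * ln \<bar>x\<bar>) else 0) +
      complex_of_real (exp (t * (pi * \<rho>))) * (if sgn x = - 1 then cis (t * ln \<bar>x\<bar>) else 0))"
  proof (rule integral_cong_AE)
    show "AE x in \<mu>. (if - (complex_of_real x * cis (- (pi * \<rho>))) = 0 then 0
      else exp (\<i> * complex_of_real t * Ln (- (complex_of_real x * cis (- (pi * \<rho>)))))) =
     complex_of_real (exp (- (t * (pi * (1 - \<rho>))))) * (if sgn x = 1 then cis (t * ln \<bar>x\<bar>) else 0) +
      complex_of_real (exp (t * (pi * \<rho>))) * (if sgn x = - 1 then cis (t * ln \<bar>x\<bar>) else 0)"
      using support
    proof eventually_elim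
      case (elim x)
      consider "x = 0" | "x > 0" | "x < 0" by linarith
      then show ?case
      proof cases
        case 2
        then show ?thesis
          unfolding pos power_on_ray[OF 2 angle(1,2)] by simp
      next
        case 3
        have "exp (\<i> * complex_of_real t * Ln (complex_of_real (- x) * cis (- (pi * \<rho>)))) =
            complex_of_real (exp (- (t * (- (pi * \<rho>))))) * cis (t * ln (- x))"
          by (rule power_on_ray) (use 3 elim bounds in linarith)+
        then show ?thesis
          unfolding neg using 3 by simp
      qed simp
    qed
  qed measurable
  finally show "S = B * (complex_of_real (exp (- (t * (pi * (1 - \<rho>))))) * signed_mellin 1 \<mu> t +
        complex_of_real (exp (t * (pi * \<rho>))) * signed_mellin (- 1) \<mu> t)"
    unfolding signed_mellin_combination .
  have "S = B * (LINT x|\<mu>. (if cnj (- (complex_of_real x * cis (- (pi * \<rho>)))) = 0 then 0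
      else exp (\<i> * complex_of_real t * Ln (cnj (- (complex_of_real x * cis (- (pi * \<rho>))))))))"
    unfolding S_def B_def
    by (rule bounded_stieltjes_average.slope_mellin_average[OF conj])
       (rule free_stable_average(2)[OF \<mu> adm \<rho>])
  also have "(LINT x|\<mu>. (if cnj (- (complex_of_real x * cis (- (pi * \<rho>)))) = 0 then 0
      else exp (\<i> * complex_of_real t * Ln (cnj (- (complex_of_real x * cis (- (pi * \<rho>)))))))) =
    (LINT x|\<mu>. complex_of_real (exp (t * (pi * (1 - \<rho>)))) * (if sgn x = 1 then cis (t * ln \<bar>x\<bar>) else 0) +
      complex_of_real (exp (- (t * (pi * \<rho>)))) * (if sgn x = - 1 then cis (t * ln \<bar>x\<bar>) else 0))"
  proof (rule Bochner_Integration.integral_cong[OF refl])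
    fix x :: real
    consider "x = 0" | "x > 0" | "x < 0" by linarith
    then show "(if cnj (- (complex_of_real x * cis (- (pi * \<rho>)))) = 0 then 0
      else exp (\<i> * complex_of_real t * Ln (cnj (- (complex_of_real x * cis (- (pi * \<rho>))))))) =
     complex_of_real (exp (t * (pi * (1 - \<rho>)))) * (if sgn x = 1 then cis (t * ln \<bar>x\<bar>) else 0) +
      complex_of_real (exp (- (t * (pi * \<rho>)))) * (if sgn x = - 1 then cis (t * ln \<bar>x\<bar>) else 0)"
    proof cases
      case 2
      then show ?thesis
        unfolding cnj_pos power_on_ray[OF 2 angle(3,4)] by simp
    next
      case 3
      have "exp (\<i> * complex_of_real t * Ln (complex_of_real (- x) * cis (pi * \<rho>))) =
          complex_of_real (exp (- (t * (pi * \<rho>)))) * cis (t * ln (- x))"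
        by (rule power_on_ray) (use 3 bounds pi_gt_zero in linarith)+
      then show ?thesis
        unfolding cnj_neg using 3 by simp
    qed simp
  qed
  finally show "S = B * (complex_of_real (exp (t * (pi * (1 - \<rho>)))) * signed_mellin 1 \<mu> t +
        complex_of_real (exp (- (t * (pi * \<rho>)))) * signed_mellin (- 1) \<mu> t)"
    unfolding signed_mellin_combination .
qed

text \<open>
  Subtract \<open>exp (- b)\<close> times the first equation from \<open>exp b\<close> times the second: the terms with \<open>n\<close> cancel.
\<close>
lemma eliminate_signed_part:
  fixes S B m n :: complex and a b :: real
  assumes "S = B * (complex_of_real (exp (- a)) * m + complex_of_real (exp b) * n)"
    and "S = B * (complex_of_real (exp a) * m + complex_of_real (exp (- b)) * n)"
  shows "complex_of_real (sinh (a + b)) * B * m = complex_of_real (sinh b) * S"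
proof -
  have "complex_of_real (exp b) * S - complex_of_real (exp (- b)) * S =
     B * (complex_of_real (exp b) * complex_of_real (exp a) * m - complex_of_real (exp (- b)) * complex_of_real (exp (- a)) * m)"
    by (subst (1) assms(2), subst (1) assms(1)) (simp add: algebra_simps)
  also have "\<dots> = B * (complex_of_real (exp (a + b)) * m - complex_of_real (exp (- (a + b))) * m)"
    by (simp add: exp_add[symmetric] add.commute flip: of_real_mult)
  finally have "(complex_of_real (exp (a + b)) - complex_of_real (exp (- (a + b)))) * B * m =
      (complex_of_real (exp b) - complex_of_real (exp (- b))) * S"
    by (simp add: left_diff_distrib right_diff_distrib mult_ac)
  moreover have "complex_of_real (sinh y) = (complex_of_real (exp y) - complex_of_real (exp (- y))) / 2" for y
    by (simp add: sinh_def)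
  ultimately show ?thesis
    by (simp only: times_divide_eq_left)
qed

text \<open>
  Solving the two linear equations for the signed transforms. The other sign follows by exchanging
  the two parts, that is, \<open>\<rho>\<close> and \<open>1 - \<rho>\<close>.
\<close>
lemma free_stable_mellin_positive_parameter:
  assumes \<mu>: "free_stable_distribution \<alpha> \<rho> \<mu>" and adm: "(\<alpha>, \<rho>) \<in> admissible" and \<rho>: "\<rho> > 0"
  shows "complex_of_real (sinh (t * pi)) * power_kernel_integral t 1 * signed_mellin 1 \<mu> t =
      complex_of_real (sinh (t * (pi * \<rho>))) * slope_mellin (free_stable_profile \<alpha>) t"
    and "complex_of_real (sinh (t * pi)) * power_kernel_integral t 1 * signed_mellin (- 1) \<mu> t =
      complex_of_real (sinh (t * (pi * (1 - \<rho>)))) * slope_mellin (free_stable_profile \<alpha>) t"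
proof -
  have sum: "t * (pi * (1 - \<rho>)) + t * (pi * \<rho>) = t * pi" "t * (pi * \<rho>) + t * (pi * (1 - \<rho>)) = t * pi"
    by (simp_all add: algebra_simps)
  note id = slope_mellin_free_stable[OF \<mu> adm \<rho>, of t]
  show "complex_of_real (sinh (t * pi)) * power_kernel_integral t 1 * signed_mellin 1 \<mu> t =
      complex_of_real (sinh (t * (pi * \<rho>))) * slope_mellin (free_stable_profile \<alpha>) t"
    using eliminate_signed_part[OF id] unfolding sum .
  show "complex_of_real (sinh (t * pi)) * power_kernel_integral t 1 * signed_mellin (- 1) \<mu> t =
      complex_of_real (sinh (t * (pi * (1 - \<rho>)))) * slope_mellin (free_stable_profile \<alpha>) t"
    using eliminate_signed_part[OF id(2,1)[unfolded add.commute[of "complex_of_real (exp _) * signed_mellin 1 \<mu> t"]]]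
    unfolding sum .
qed

lemma signed_mellin_reflect:
  assumes "real_distribution \<mu>"
  shows "signed_mellin s (distr \<mu> borel uminus) t = signed_mellin (- s) \<mu> t"
proof -
  interpret real_distribution \<mu> by fact
  have flip: "sgn (- x) = s \<longleftrightarrow> sgn x = - s" for x :: real
    by (auto simp: sgn_minus)
  show ?thesis
    unfolding signed_mellin_def by (subst integral_distr) (simp_all only: flip abs_minus_cancel, auto)
qed

text \<open>
  The factor of the signed Mellin transforms that is shared by all free stable laws of index \<open>\<alpha>\<close>.
  At \<open>t = 0\<close> the denominator vanishes and the value has no meaning.
\<close>
definition mellin_quotient :: "real \<Rightarrow> real \<Rightarrow> complex" where
  "mellin_quotient \<alpha> t = slope_mellin (free_stable_profile \<alpha>) t /
     (complex_of_real (sinh (t * pi)) * power_kernel_integral t 1)"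

text \<open>
  For \<open>\<rho> = 0\<close> the law is the reflection of the one with parameter \<open>1\<close>.
\<close>
theorem free_stable_mellin:
  assumes \<mu>: "free_stable_distribution \<alpha> \<rho> \<mu>" and adm: "(\<alpha>, \<rho>) \<in> admissible" and t: "t \<noteq> 0"
  shows "signed_mellin 1 \<mu> t = complex_of_real (sinh (t * (pi * \<rho>))) * mellin_quotient \<alpha> t"
    and "signed_mellin (- 1) \<mu> t = complex_of_real (sinh (t * (pi * (1 - \<rho>)))) * mellin_quotient \<alpha> t"
proof -
  have rd: "real_distribution \<mu>"
    using \<mu> by (simp add: free_stable_distribution_def)
  have nz: "complex_of_real (sinh (t * pi)) * power_kernel_integral t 1 \<noteq> 0"
    using t power_kernel_integral_1_nonzero by simp
  have quotient: "m = complex_of_real y * mellin_quotient \<alpha> t"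
    if "complex_of_real (sinh (t * pi)) * power_kernel_integral t 1 * m =
      complex_of_real y * slope_mellin (free_stable_profile \<alpha>) t" for m y
    using that nz unfolding mellin_quotient_def by (simp add: field_simps)
  have "signed_mellin 1 \<mu> t = complex_of_real (sinh (t * (pi * \<rho>))) * mellin_quotient \<alpha> t \<and>
    signed_mellin (- 1) \<mu> t = complex_of_real (sinh (t * (pi * (1 - \<rho>)))) * mellin_quotient \<alpha> t"
  proof (cases "\<rho> = 0")
    case False
    then have "\<rho> > 0" using admissibleD(3)[OF adm] by simp
    then show ?thesis
      using quotient free_stable_mellin_positive_parameter[OF \<mu> adm] by blast
  next
    case True
    then have "(\<alpha>, 1 - \<rho>) \<in> admissible"
      using admissibleD(1,5)[OF adm] by (simp add: admissible_def)
    moreover have "1 - \<rho> > 0"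
      using True by simp
    ultimately have
      "complex_of_real (sinh (t * pi)) * power_kernel_integral t 1 * signed_mellin (- 1) \<mu> t =
        complex_of_real (sinh (t * (pi * (1 - \<rho>)))) * slope_mellin (free_stable_profile \<alpha>) t"
      "complex_of_real (sinh (t * pi)) * power_kernel_integral t 1 * signed_mellin 1 \<mu> t =
        complex_of_real (sinh (t * (pi * (1 - (1 - \<rho>))))) * slope_mellin (free_stable_profile \<alpha>) t"
      using free_stable_mellin_positive_parameter[OF free_stable_reflect[OF \<mu>], of t]
      unfolding signed_mellin_reflect[OF rd] minus_minus by blast+
    from this[THEN quotient] show ?thesis
      by simp
  qed
  then show "signed_mellin 1 \<mu> t = complex_of_real (sinh (t * (pi * \<rho>))) * mellin_quotient \<alpha> t"
    and "signed_mellin (- 1) \<mu> t = complex_of_real (sinh (t * (pi * (1 - \<rho>)))) * mellin_quotient \<alpha> t"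
    by auto
qed

text \<open>
  For \<open>t \<noteq> 0\<close> both sides are \<open>- \<sigma>\<^sub>1(t) \<sigma>\<^sub>2(t) D(t) D(- t)\<close>, where \<open>\<sigma>\<^sub>1\<close> and \<open>\<sigma>\<^sub>2\<close> are the odd \<open>sinh\<close> factors
  and \<open>D\<close> is the common quotient.
\<close>
lemma free_stable_mellin_symmetric:
  assumes "free_stable_distribution \<alpha> \<rho>\<^sub>1 \<mu>\<^sub>1" "(\<alpha>, \<rho>\<^sub>1) \<in> admissible"
    and "free_stable_distribution \<alpha> \<rho>\<^sub>2 \<mu>\<^sub>2" "(\<alpha>, \<rho>\<^sub>2) \<in> admissible"
    and "s\<^sub>1 \<in> {1, - 1}" "s\<^sub>2 \<in> {1, - 1}"
  shows "signed_mellin s\<^sub>1 \<mu>\<^sub>1 t * signed_mellin s\<^sub>2 \<mu>\<^sub>2 (- t) =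
    signed_mellin s\<^sub>1 \<mu>\<^sub>1 (- t) * signed_mellin s\<^sub>2 \<mu>\<^sub>2 t"
proof (cases "t = 0")
  case False
  define \<sigma> where "\<sigma> = (\<lambda>s \<rho> t. sinh (t * (pi * (if s = (1::real) then \<rho> else 1 - \<rho>))))"
  have \<sigma>: "\<sigma> s \<rho> (- t) = - \<sigma> s \<rho> t" for s \<rho>
    by (simp add: \<sigma>_def)
  have m: "signed_mellin s \<mu> u = complex_of_real (\<sigma> s \<rho> u) * mellin_quotient \<alpha> u"
    if "free_stable_distribution \<alpha> \<rho> \<mu>" "(\<alpha>, \<rho>) \<in> admissible" "s \<in> {1, - 1}" "u \<noteq> 0" for s \<rho> \<mu> u
    using free_stable_mellin[OF that(1,2,4)] that(3) by (auto simp: \<sigma>_def)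
  have "- t \<noteq> 0" using False by simp
  show ?thesis
    unfolding m[OF assms(1,2,5) False] m[OF assms(1,2,5) \<open>- t \<noteq> 0\<close>]
      m[OF assms(3,4,6) False] m[OF assms(3,4,6) \<open>- t \<noteq> 0\<close>] \<sigma>
    by (simp add: mult_ac)
qed simp

section \<open>Ratios of independent variables\<close>

text \<open>
  Collapsing everything outside the half-line to the value \<open>0\<close> turns a half-line of \<open>\<mu>\<close>, of possibly
  small mass, into a probability measure, at the cost of a constant that depends neither on \<open>k\<close> nor
  on \<open>t\<close>.
\<close>
lemma char_log_part:
  assumes "real_distribution \<mu>"
  shows "char (distr \<mu> borel (\<lambda>x. if sgn x = s then k * ln \<bar>x\<bar> else 0)) t =
    signed_mellin s \<mu> (k * t) + complex_of_real (measure \<mu> {x. sgn x \<noteq> s})"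
proof -
  interpret real_distribution \<mu> by fact
  have "char (distr \<mu> borel (\<lambda>x. if sgn x = s then k * ln \<bar>x\<bar> else 0)) t =
      (LINT x|\<mu>. (if sgn x = s then cis (k * t * ln \<bar>x\<bar>) else 0) + complex_of_real (indicator {x. sgn x \<noteq> s} x))"
    unfolding char_def
    by (subst integral_distr)
       (auto intro!: Bochner_Integration.integral_cong simp: cis_conv_exp mult_ac)
  also have "\<dots> = signed_mellin s \<mu> (k * t) + (LINT x|\<mu>. complex_of_real (indicator {x. sgn x \<noteq> s} x))"
    unfolding signed_mellin_def
  proof (rule Bochner_Integration.integral_add)
    show "integrable \<mu> (\<lambda>x. if sgn x = s then cis (k * t * ln \<bar>x\<bar>) else 0)"
      by (rule integrable_const_bound[where B = 1]) auto
    show "integrable \<mu> (\<lambda>x. complex_of_real (indicator {x. sgn x \<noteq> s} x))"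
      by (rule integrable_const_bound[where B = 1]) (auto simp: indicator_def)
  qed
  also have "(LINT x|\<mu>. complex_of_real (indicator {x. sgn x \<noteq> s} x)) = complex_of_real (measure \<mu> {x. sgn x \<noteq> s})"
    unfolding integral_complex_of_real by simp
  finally show ?thesis .
qed

text \<open>
  On each half-line inversion changes the sign of \<open>ln \<bar>x\<bar>\<close>, hence replaces \<open>t\<close> by \<open>- t\<close> in the Mellin
  transform, and Levy's uniqueness theorem applies. Since \<open>inverse 0 = 0\<close>, a possible atom at \<open>0\<close> is
  preserved as well.
\<close>
lemma inversion_invariant:
  assumes rd: "real_distribution \<mu>"
    and sym: "\<And>s t. s \<in> {1, - 1} \<Longrightarrow> signed_mellin s \<mu> (- t) = signed_mellin s \<mu> t"
  shows "distr \<mu> borel inverse = \<mu>"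
proof -
  interpret real_distribution \<mu> by fact
  define L where "L = (\<lambda>k s x::real. if sgn x = s then k * ln \<bar>x\<bar> else (0::real))"
  have L_measurable [measurable]: "L k s \<in> borel_measurable borel" for k s
    unfolding L_def by measurable
  have part: "measure \<mu> {x \<in> A. sgn x = s} = measure \<mu> {x. inverse x \<in> A \<and> sgn x = s}"
    if A [measurable]: "A \<in> sets borel" and s: "s \<in> {1, - 1}" for A s
  proof -
    have "distr \<mu> borel (L 1 s) = distr \<mu> borel (L (- 1) s)"
    proof (rule Levy_uniqueness)
      show "char (distr \<mu> borel (L 1 s)) = char (distr \<mu> borel (L (- 1) s))"
        unfolding L_def by (rule ext, simp only: char_log_part[OF rd]) (use sym[OF s] in simp)
    qed (auto intro: real_distribution_distr)
    then have law: "measure \<mu> (L 1 s -` B) = measure \<mu> (L (- 1) s -` B)" if [measurable]: "B \<in> sets borel" for B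
    proof -
      have "measure (distr \<mu> borel (L k s)) B = measure \<mu> (L k s -` B)" for k
        by (simp add: measure_distr)
      then show ?thesis
        using \<open>distr \<mu> borel (L 1 s) = distr \<mu> borel (L (- 1) s)\<close> by metis
    qed
    \<comment> \<open>the second term, from the collapsed values, is the same for \<open>k = 1\<close> and \<open>k = - 1\<close> and cancels\<close>
    have split: "measure \<mu> (L k s -` ((\<lambda>y. s * exp y) -` A)) =
        measure \<mu> {x. s * exp (k * ln \<bar>x\<bar>) \<in> A \<and> sgn x = s} + measure \<mu> {x. s \<in> A \<and> sgn x \<noteq> s}" for k
    proof -
      have "L k s -` ((\<lambda>y. s * exp y) -` A) =
          {x. s * exp (k * ln \<bar>x\<bar>) \<in> A \<and> sgn x = s} \<union> {x. s \<in> A \<and> sgn x \<noteq> s}"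
        by (auto simp: L_def split: if_splits)
      then show ?thesis
        by (subst finite_measure_Union[symmetric]) auto
    qed
    have "(\<lambda>y. s * exp y) -` A \<in> sets borel"
      using measurable_sets[of "\<lambda>y. s * exp y" borel borel A] by simp
    from law[OF this] have "measure \<mu> {x. s * exp (1 * ln \<bar>x\<bar>) \<in> A \<and> sgn x = s} =
        measure \<mu> {x. s * exp (- 1 * ln \<bar>x\<bar>) \<in> A \<and> sgn x = s}"
      unfolding split by linarith
    moreover have "{x. s * exp (1 * ln \<bar>x\<bar>) \<in> A \<and> sgn x = s} = {x \<in> A. sgn x = s}"
      using s by (auto simp: sgn_if split: if_splits)
    moreover have "{x. s * exp (- 1 * ln \<bar>x\<bar>) \<in> A \<and> sgn x = s} = {x. inverse x \<in> A \<and> sgn x = s}"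
      using s by (auto simp: sgn_if exp_minus split: if_splits)
    ultimately show ?thesis by simp
  qed
  have decompose: "measure \<mu> {x. P x} = measure \<mu> {x. P x \<and> sgn x = 1} +
      measure \<mu> {x. P x \<and> sgn x = - 1} + measure \<mu> {x. P x \<and> x = 0}"
    if [measurable]: "Measurable.pred borel P" for P
  proof -
    have "{x. P x} = ({x. P x \<and> sgn x = 1} \<union> {x. P x \<and> sgn x = - 1}) \<union> {x. P x \<and> x = 0}"
      by (auto simp: sgn_if)
    then have "measure \<mu> {x. P x} =
        measure \<mu> ({x. P x \<and> sgn x = 1} \<union> {x. P x \<and> sgn x = - 1}) + measure \<mu> {x. P x \<and> x = 0}"
      by (simp only:) (rule finite_measure_Union; auto)
    also have "measure \<mu> ({x. P x \<and> sgn x = 1} \<union> {x. P x \<and> sgn x = - 1}) =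
        measure \<mu> {x. P x \<and> sgn x = 1} + measure \<mu> {x. P x \<and> sgn x = - 1}"
      by (rule finite_measure_Union) auto
    finally show ?thesis .
  qed
  show ?thesis
  proof (rule measure_eqI)
    fix A assume "A \<in> sets (distr \<mu> borel inverse)"
    then have [measurable]: "A \<in> sets borel" by simp
    have "measure \<mu> {x. inverse x \<in> A} = measure \<mu> {x. x \<in> A}"
    proof -
      have "{x. inverse x \<in> A \<and> x = 0} = {x. x \<in> A \<and> x = 0}"
        by auto
      moreover have "measure \<mu> {x. inverse x \<in> A} = measure \<mu> {x. inverse x \<in> A \<and> sgn x = 1} +
          measure \<mu> {x. inverse x \<in> A \<and> sgn x = - 1} + measure \<mu> {x. inverse x \<in> A \<and> x = 0}"
        by (rule decompose) measurable
      moreover have "measure \<mu> {x. x \<in> A} = measure \<mu> {x. x \<in> A \<and> sgn x = 1} +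
          measure \<mu> {x. x \<in> A \<and> sgn x = - 1} + measure \<mu> {x. x \<in> A \<and> x = 0}"
        by (rule decompose) measurable
      ultimately show ?thesis
        using part[of A 1] part[of A "- 1"] by simp
    qed
    then show "emeasure (distr \<mu> borel inverse) A = emeasure \<mu> A"
      by (subst emeasure_distr) (auto simp: emeasure_eq_measure vimage_def)
  qed simp
qed

text \<open>
  The sign of \<open>U / V\<close> is the product of the signs and \<open>ln \<bar>U / V\<bar>\<close> the difference of the logarithms, so
  the integrand splits according to the sign of \<open>V\<close> and each piece factorizes by independence. Where
  \<open>U\<close> or \<open>V\<close> vanishes, all terms are \<open>0\<close>.
\<close>
lemma (in prob_space) signed_mellin_ratio:
  assumes indep: "indep_var borel U borel V" and s: "s \<in> {1, - 1}"
  shows "signed_mellin s (distr M borel (\<lambda>\<omega>. U \<omega> / V \<omega>)) t =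
    signed_mellin s (distr M borel U) t * signed_mellin 1 (distr M borel V) (- t) +
    signed_mellin (- s) (distr M borel U) t * signed_mellin (- 1) (distr M borel V) (- t)"
proof -
  define f where "f = (\<lambda>e t x::real. if sgn x = e then cis (t * ln \<bar>x\<bar>) else 0)"
  have f_measurable [measurable]: "f e t \<in> borel_measurable borel" for e t
    unfolding f_def by measurable
  have [measurable]: "U \<in> borel_measurable M" "V \<in> borel_measurable M"
    using indep_var_rv1[OF indep] indep_var_rv2[OF indep] by auto
  have f_integrable: "integrable M (\<lambda>\<omega>. f e t (W \<omega>))" if [measurable]: "W \<in> borel_measurable M" for e t W
    by (rule integrable_const_bound[where B = 1]) (auto simp: f_def)
  have mellin: "signed_mellin e (distr M borel W) t = (LINT \<omega>|M. f e t (W \<omega>))"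
    if [measurable]: "W \<in> borel_measurable M" for e t W
    unfolding signed_mellin_def f_def by (subst integral_distr) auto
  have indep_f: "indep_var borel (\<lambda>\<omega>. f e t (U \<omega>)) borel (\<lambda>\<omega>. f e' t' (V \<omega>))" for e t e' t'
    using indep_var_compose[OF indep f_measurable f_measurable] by (simp add: o_def)
  have "f s t (x / y) = f s t x * f 1 (- t) y + f (- s) t x * f (- 1) (- t) y" for x y
  proof (cases "x = 0 \<or> y = 0")
    case False
    then have "ln \<bar>x / y\<bar> = ln \<bar>x\<bar> - ln \<bar>y\<bar>"
      by (simp add: ln_div)
    then have "cis (t * ln \<bar>x / y\<bar>) = cis (t * ln \<bar>x\<bar>) * cis (- t * ln \<bar>y\<bar>)"
      by (simp only: cis_mult right_diff_distrib) simp
    then show ?thesis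
      using False s by (auto simp: f_def sgn_if zero_less_divide_iff divide_less_0_iff split: if_splits)
  qed (use s in \<open>auto simp: f_def\<close>)
  then have "signed_mellin s (distr M borel (\<lambda>\<omega>. U \<omega> / V \<omega>)) t =
    (LINT \<omega>|M. f s t (U \<omega>) * f 1 (- t) (V \<omega>) + f (- s) t (U \<omega>) * f (- 1) (- t) (V \<omega>))"
    by (subst mellin) auto
  also have "\<dots> = (LINT \<omega>|M. f s t (U \<omega>) * f 1 (- t) (V \<omega>)) + (LINT \<omega>|M. f (- s) t (U \<omega>) * f (- 1) (- t) (V \<omega>))"
    by (intro Bochner_Integration.integral_add indep_var_integrable indep_f f_integrable) auto
  also have "\<dots> = (LINT \<omega>|M. f s t (U \<omega>)) * (LINT \<omega>|M. f 1 (- t) (V \<omega>)) +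
      (LINT \<omega>|M. f (- s) t (U \<omega>)) * (LINT \<omega>|M. f (- 1) (- t) (V \<omega>))"
    by (intro arg_cong2[where f = plus] indep_var_lebesgue_integral indep_f f_integrable) auto
  finally show ?thesis
    by (simp add: mellin)
qed

lemma (in prob_space) ratio_inversion_symmetric:
  assumes indep: "indep_var borel U borel V"
    and sym: "\<And>s e t. s \<in> {1, - 1} \<Longrightarrow> e \<in> {1, - 1} \<Longrightarrow>
      signed_mellin s (distr M borel U) t * signed_mellin e (distr M borel V) (- t) =
      signed_mellin s (distr M borel U) (- t) * signed_mellin e (distr M borel V) t"
  shows "distr M borel (\<lambda>\<omega>. U \<omega> / V \<omega>) = distr M borel (\<lambda>\<omega>. V \<omega> / U \<omega>)"
proof -
  have [measurable]: "U \<in> borel_measurable M" "V \<in> borel_measurable M"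
    using indep_var_rv1[OF indep] indep_var_rv2[OF indep] by auto
  have "distr (distr M borel (\<lambda>\<omega>. U \<omega> / V \<omega>)) borel inverse = distr M borel (\<lambda>\<omega>. U \<omega> / V \<omega>)"
  proof (rule inversion_invariant)
    fix s t :: real assume "s \<in> {1, - 1}"
    then show "signed_mellin s (distr M borel (\<lambda>\<omega>. U \<omega> / V \<omega>)) (- t) =
        signed_mellin s (distr M borel (\<lambda>\<omega>. U \<omega> / V \<omega>)) t"
      using sym[of s 1 t] sym[of "- s" "- 1" t]
      unfolding signed_mellin_ratio[OF indep \<open>s \<in> {1, - 1}\<close>] minus_minus by auto
  qed simp
  moreover have "distr (distr M borel (\<lambda>\<omega>. U \<omega> / V \<omega>)) borel inverse = distr M borel (\<lambda>\<omega>. V \<omega> / U \<omega>)"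
    by (subst distr_distr) (auto simp: o_def)
  ultimately show ?thesis by simp
qed

section \<open>Cutoffs\<close>

text \<open>
  The normalizing constant \<open>p\<close>, the probability of \<open>\<xi> > 0\<close>, is positive because a conditional probability
  given a null event is \<open>0\<close> by convention, whereas \<open>\<eta>\<close> is almost surely positive.
\<close>
lemma cutoff_law:
  assumes M: "prob_space M" and N: "prob_space N" and \<xi>: "\<xi> \<in> borel_measurable M"
    and cutoff: "is_cutoff M \<xi> N \<eta>"
  obtains p :: real where "p > 0"
    "distr N borel \<eta> = density (distr M borel \<xi>) (\<lambda>x. ennreal (indicator {0<..} x / p))"
proof -
  interpret M: prob_space M by fact
  interpret N: prob_space N by fact
  note [measurable] = \<xi>
  have \<eta> [measurable]: "\<eta> \<in> borel_measurable N" and pos: "AE \<omega> in N. \<eta> \<omega> > 0"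
    and law: "\<And>A. A \<in> sets borel \<Longrightarrow> A \<subseteq> {0<..} \<Longrightarrow>
      \<P>(\<omega> in N. \<eta> \<omega> \<in> A) = \<P>(\<omega> in M. \<xi> \<omega> \<in> A \<bar> \<xi> \<omega> > 0)"
    using cutoff by (auto simp: is_cutoff_def)
  define p where "p = \<P>(\<omega> in M. \<xi> \<omega> > 0)"
  have "\<P>(\<omega> in N. \<eta> \<omega> \<in> {0<..}) = 1"
    using pos by (intro N.prob_Collect_eq_1[THEN iffD2]) auto
  then have "p \<noteq> 0"
    using law[of "{0<..}"] by (auto simp: cond_prob_def p_def)
  then have p: "p > 0"
    by (simp add: p_def zero_less_measure_iff)
  have "distr N borel \<eta> = density (distr M borel \<xi>) (\<lambda>x. ennreal (indicator {0<..} x / p))"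
  proof (rule measure_eqI)
    fix B assume "B \<in> sets (distr N borel \<eta>)"
    then have B [measurable]: "B \<in> sets borel" by simp
    have "emeasure (distr N borel \<eta>) B = ennreal (\<P>(\<omega> in N. \<eta> \<omega> \<in> B))"
      by (subst emeasure_distr) (auto simp: N.emeasure_eq_measure vimage_def Int_def conj_commute)
    also have "\<P>(\<omega> in N. \<eta> \<omega> \<in> B) = \<P>(\<omega> in N. \<eta> \<omega> \<in> B \<inter> {0<..})"
      using pos by (intro N.prob_eq_AE) auto
    also have "\<dots> = \<P>(\<omega> in M. \<xi> \<omega> \<in> B \<inter> {0<..}) / p"
      by (subst law) (auto simp: cond_prob_def p_def intro!: arg_cong2[where f = divide] arg_cong[where f = "measure M"])
    also have "ennreal \<dots> = ennreal (1 / p) * emeasure (distr M borel \<xi>) (B \<inter> {0<..})"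
      using p by (subst emeasure_distr)
        (auto simp: M.emeasure_eq_measure vimage_def Int_def conj_commute conj_left_commute simp flip: ennreal_mult)
    also have "\<dots> = (\<integral>\<^sup>+x. ennreal (1 / p) * indicator (B \<inter> {0<..}) x \<partial>distr M borel \<xi>)"
      by (subst nn_integral_cmult_indicator) auto
    also have "\<dots> = emeasure (density (distr M borel \<xi>) (\<lambda>x. ennreal (indicator {0<..} x / p))) B"
      by (subst emeasure_density) (auto intro!: nn_integral_cong split: split_indicator)
    finally show "emeasure (distr N borel \<eta>) B =
        emeasure (density (distr M borel \<xi>) (\<lambda>x. ennreal (indicator {0<..} x / p))) B" .
  qed simp
  then show ?thesis
    using that p by blast
qed

text \<open>
  A cutoff rescales the positive part and removes the negative one, so the symmetry of products of signed
  transforms is inherited.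
\<close>
lemma signed_mellin_cutoff:
  assumes "prob_space M" "prob_space N" "\<xi> \<in> borel_measurable M" "is_cutoff M \<xi> N \<eta>"
  obtains k where "\<And>s t. s \<in> {1, - 1} \<Longrightarrow>
    signed_mellin s (distr N borel \<eta>) t = k s * signed_mellin s (distr M borel \<xi>) t"
proof -
  obtain p where p: "p > 0"
    "distr N borel \<eta> = density (distr M borel \<xi>) (\<lambda>x. ennreal (indicator {0<..} x / p))"
    using cutoff_law[OF assms] by blast
  have density: "signed_mellin s (distr N borel \<eta>) t =
      (LINT x|distr M borel \<xi>. (indicator {0<..} x / p) *\<^sub>R (if sgn x = s then cis (t * ln \<bar>x\<bar>) else 0))" for s t
    unfolding signed_mellin_def p(2) by (rule integral_density) (use p(1) assms(3) in auto)
  have "signed_mellin s (distr N borel \<eta>) t =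
      complex_of_real (if s = 1 then 1 / p else 0) * signed_mellin s (distr M borel \<xi>) t"
    if "s \<in> {1, - 1}" for s t
    unfolding density unfolding signed_mellin_def integral_mult_right_zero[symmetric]
    using that by (intro Bochner_Integration.integral_cong) (auto simp: sgn_if scaleR_conv_of_real split: split_indicator if_splits)
  then show ?thesis
    by (rule that)
qed

theorem corollary4:
  fixes \<alpha> \<rho>\<^sub>1 \<rho>\<^sub>2 :: real
    and M :: "'a measure" and X\<^sub>1 X\<^sub>2 :: "'a \<Rightarrow> real"
  assumes "(\<alpha>, \<rho>\<^sub>1) \<in> admissible" and "(\<alpha>, \<rho>\<^sub>2) \<in> admissible"
    and "prob_space M"
    and "prob_space.indep_var M borel X\<^sub>1 borel X\<^sub>2"
    and "free_stable_distribution \<alpha> \<rho>\<^sub>1 (distr M borel X\<^sub>1)"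
    and "free_stable_distribution \<alpha> \<rho>\<^sub>2 (distr M borel X\<^sub>2)"
  shows "distr M borel (\<lambda>\<omega>. X\<^sub>1 \<omega> / X\<^sub>2 \<omega>) = distr M borel (\<lambda>\<omega>. X\<^sub>2 \<omega> / X\<^sub>1 \<omega>) \<and>
    (\<rho>\<^sub>1 \<noteq> 0 \<and> \<rho>\<^sub>2 \<noteq> 0 \<longrightarrow>
      (\<forall>(N :: 'b measure) Y\<^sub>1 Y\<^sub>2.
        prob_space N \<and> prob_space.indep_var N borel Y\<^sub>1 borel Y\<^sub>2 \<and>
        is_cutoff M X\<^sub>1 N Y\<^sub>1 \<and> is_cutoff M X\<^sub>2 N Y\<^sub>2 \<longrightarrow>
        distr N borel (\<lambda>\<omega>. Y\<^sub>1 \<omega> / Y\<^sub>2 \<omega>) = distr N borel (\<lambda>\<omega>. Y\<^sub>2 \<omega> / Y\<^sub>1 \<omega>)))"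
proof -
  interpret M: prob_space M by fact
  have X_measurable: "X\<^sub>1 \<in> borel_measurable M" "X\<^sub>2 \<in> borel_measurable M"
    using M.indep_var_rv1[OF assms(4)] M.indep_var_rv2[OF assms(4)] by auto
  have sym: "signed_mellin s (distr M borel X\<^sub>1) t * signed_mellin e (distr M borel X\<^sub>2) (- t) =
      signed_mellin s (distr M borel X\<^sub>1) (- t) * signed_mellin e (distr M borel X\<^sub>2) t"
    if "s \<in> {1, - 1}" "e \<in> {1, - 1}" for s e t
    by (rule free_stable_mellin_symmetric[OF assms(5,1,6,2) that])
  have "distr N borel (\<lambda>\<omega>. Y\<^sub>1 \<omega> / Y\<^sub>2 \<omega>) = distr N borel (\<lambda>\<omega>. Y\<^sub>2 \<omega> / Y\<^sub>1 \<omega>)"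
    if N: "prob_space N" and indep: "prob_space.indep_var N borel Y\<^sub>1 borel Y\<^sub>2"
      and cutoff: "is_cutoff M X\<^sub>1 N Y\<^sub>1" "is_cutoff M X\<^sub>2 N Y\<^sub>2"
    for N :: "'b measure" and Y\<^sub>1 Y\<^sub>2
  proof -
    obtain k\<^sub>1 where k\<^sub>1: "\<And>s t. s \<in> {1, - 1} \<Longrightarrow>
        signed_mellin s (distr N borel Y\<^sub>1) t = k\<^sub>1 s * signed_mellin s (distr M borel X\<^sub>1) t"
      using signed_mellin_cutoff[OF assms(3) N X_measurable(1) cutoff(1)] by blast
    obtain k\<^sub>2 where k\<^sub>2: "\<And>s t. s \<in> {1, - 1} \<Longrightarrow>
        signed_mellin s (distr N borel Y\<^sub>2) t = k\<^sub>2 s * signed_mellin s (distr M borel X\<^sub>2) t"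
      using signed_mellin_cutoff[OF assms(3) N X_measurable(2) cutoff(2)] by blast
    show ?thesis
    proof (rule prob_space.ratio_inversion_symmetric[OF N indep])
      fix s e t :: real
      assume s: "s \<in> {1, - 1}" and e: "e \<in> {1, - 1}"
      have "k\<^sub>1 s * k\<^sub>2 e * (signed_mellin s (distr M borel X\<^sub>1) t * signed_mellin e (distr M borel X\<^sub>2) (- t)) =
          k\<^sub>1 s * k\<^sub>2 e * (signed_mellin s (distr M borel X\<^sub>1) (- t) * signed_mellin e (distr M borel X\<^sub>2) t)"
        by (simp only: sym[OF s e])
      then show "signed_mellin s (distr N borel Y\<^sub>1) t * signed_mellin e (distr N borel Y\<^sub>2) (- t) =
          signed_mellin s (distr N borel Y\<^sub>1) (- t) * signed_mellin e (distr N borel Y\<^sub>2) t"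
        by (simp only: k\<^sub>1[OF s] k\<^sub>2[OF e] mult_ac)
    qed
  qed
  then show ?thesis
    using M.ratio_inversion_symmetric[OF assms(4) sym] by blast
qed

end
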